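(* Let $\kappa,\tau>0$ and $\alpha>\frac12$. Let $\Gamma$ be a compact metric graph that has a vertex $v_i$ of degree $2$, connected to edges $e_k$ and $e_\ell$, and let $\widetilde\Gamma$ be the metric graph obtained by removing $v_i$ and merging $e_k,e_\ell$ into one new edge $\widetilde e_k$ (of length $\ell_{e_k}+\ell_{e_\ell}$). Let $u$ be the solution of $L^{\alpha/2}(\tau u)=\mathcal{W}$ on $\Gamma$ and $\widetilde u$ the solution of the corresponding equation (same $\kappa,\tau,\alpha$) on $\widetilde\Gamma$. Then, under the natural identification of the points of $\Gamma$ with the points of $\widetilde\Gamma$, $u$ and $\widetilde u$ have the same covariance function.
   Context: Graph. A compact metric graph $\Gamma$ is a connected graph with a finite set $\mathcal{V}$ of vertices and a finite set $\mathcal{E}$ of edges (loops and multiple edges allowed); each edge $e$ joins a pair of vertices, has a length $\ell_e\in(0,\infty)$, and is identified with the interval $[0,\ell_e]$, its endpoints being identified with its vertices. $\mathcal{E}_v$ denotes the edges incident to $v\in\mathcal{V}$. $L_2(\Gamma)=\bigoplus_{e}L_2(e)$ (Lebesgue measure on each edge); $C(\Gamma)$ is the space of continuous functions on $\Gamma$; $\widetilde H^k(\Gamma)=\bigoplus_e H^k(e)$. Operator. The Kirchhoff Laplacian $\Delta_\Gamma$ acts as $f_e\mapsto f_e''$ on each edge, with domain $\{f\in\widetilde H^2(\Gamma)\cap C(\Gamma): \sum_{e\in\mathcal{E}_v}\partial_e f(v)=0\ \forall v\in\mathcal{V}\}$, where $\partial_e$ is the derivative along $e$ in the direction away from $v$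 (a loop at $v$ contributes one term for each of its two ends). $L=\kappa^2-\Delta_\Gamma$ is self-adjoint, positive definite, with discrete spectrum; $\{\varphi_i\}_{i\in\mathbb{N}}$ is an $L_2(\Gamma)$-orthonormal eigenbasis with eigenvalues $0<\lambda_1\le\lambda_2\le\cdots$, and fractional powers are defined spectrally: $L^{\beta}\phi=\sum_i\lambda_i^{\beta}(\phi,\varphi_i)_{L_2(\Gamma)}\varphi_i$. Field. $\mathcal{W}$ is Gaussian white noise on $L_2(\Gamma)$: a centered Gaussian family $\{\mathcal{W}(h):h\in L_2(\Gamma)\}$ with $\mathbb{E}[\mathcal{W}(h)\mathcal{W}(g)]=(h,g)_{L_2(\Gamma)}$. For $\alpha>\frac12$ the equation $L^{\alpha/2}(\tau u)=\mathcal{W}$ has a unique solution, the centered Gaussian $L_2(\Gamma)$-valued random variable with $(u,\psi)_{L_2(\Gamma)}=\mathcal{W}(\tau^{-1}L^{-\alpha/2}\psi)$ a.s. for all $\psi\in L_2(\Gamma)$. Its covariance function is $\varrho(s,s')=\mathbb{E}(u(s)u(s'))$ (a.e. on $\Gamma\times\Gamma$), the kernel of the covariance operator $\tau^{-2}L^{-\alpha}$. *)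

theory Defs
  imports "HOL-Probability.Probability" "Graph_Theory.Digraph_Component"
begin

section \<open>Compact metric graphs\<close>

text \<open>
  The direction of an arc only records its parametrisation: the arc \<open>e\<close> is the interval
  \<open>[0, len e]\<close>, with \<open>0\<close> glued to \<open>tail G e\<close> and \<open>len e\<close> glued to \<open>head G e\<close>.
  \<open>Digraph_Component.connected\<close> is connectedness of the underlying undirected graph.
\<close>

locale compact_metric_graph = fin_digraph G
  for G :: "('v, 'e) pre_digraph" and len :: "'e \<Rightarrow> real" +
  assumes connected: "Digraph_Component.connected G"
    and len_pos: "e \<in> arcs G \<Longrightarrow> 0 < len e"

text \<open>
  A point of the metric graph is a pair of an edge and a coordinate. Endpoints of edges are not
  identified at this level; this only affects finitely many points, hence no \<open>L\<^sub>2\<close> notion, and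
  continuity at the vertices is imposed in \<open>continuous_on_graph\<close>.
\<close>

type_synonym 'e point = "'e \<times> real"

definition graph_points :: "('v, 'e) pre_digraph \<Rightarrow> ('e \<Rightarrow> real) \<Rightarrow> 'e point set" where
  "graph_points G len = (SIGMA e:arcs G. {0..len e})"

definition graph_measure :: "('v, 'e) pre_digraph \<Rightarrow> ('e \<Rightarrow> real) \<Rightarrow> 'e point measure" where
  "graph_measure G len =
     restrict_space (count_space (arcs G) \<Otimes>\<^sub>M lborel) (graph_points G len)"

definition continuous_on_graph ::
  "('v, 'e) pre_digraph \<Rightarrow> ('e \<Rightarrow> real) \<Rightarrow> ('e point \<Rightarrow> real) \<Rightarrow> bool" where
  "continuous_on_graph G len f \<longleftrightarrow>
     (\<forall>e\<in>arcs G. continuous_on {0..len e} (\<lambda>t. f (e, t))) \<and>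
     (\<exists>val. \<forall>e\<in>arcs G. f (e, 0) = val (tail G e) \<and> f (e, len e) = val (head G e))"


section \<open>The space of square integrable functions\<close>

text \<open>Elements of \<open>L\<^sub>2\<close> are represented by functions; equality in \<open>L\<^sub>2\<close> is equality a.e.\<close>

definition L2 :: "'a measure \<Rightarrow> ('a \<Rightarrow> real) set" where
  "L2 \<mu> = {f \<in> borel_measurable \<mu>. integrable \<mu> (\<lambda>x. (f x)\<^sup>2)}"

definition L2_inner :: "'a measure \<Rightarrow> ('a \<Rightarrow> real) \<Rightarrow> ('a \<Rightarrow> real) \<Rightarrow> real" where
  "L2_inner \<mu> f g = (\<integral>x. f x * g x \<partial>\<mu>)"

definition L2_norm :: "'a measure \<Rightarrow> ('a \<Rightarrow> real) \<Rightarrow> real" where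
  "L2_norm \<mu> f = sqrt (L2_inner \<mu> f f)"

definition L2_sums :: "'a measure \<Rightarrow> (nat \<Rightarrow> 'a \<Rightarrow> real) \<Rightarrow> ('a \<Rightarrow> real) \<Rightarrow> bool" where
  "L2_sums \<mu> f g \<longleftrightarrow> (\<lambda>n. L2_norm \<mu> (\<lambda>x. g x - (\<Sum>i<n. f i x))) \<longlonglongrightarrow> 0"


section \<open>Sobolev functions and the Kirchhoff Laplacian\<close>

text \<open>
  \<open>weak_derivative l f g\<close>: the functions \<open>f\<close>, \<open>g\<close> are in \<open>L\<^sub>2(0,l)\<close>, and \<open>g\<close> is the weak
  derivative of \<open>f\<close> there, tested against continuously differentiable functions with compact
  support in the open interval.
\<close>

definition weak_derivative :: "real \<Rightarrow> (real \<Rightarrow> real) \<Rightarrow> (real \<Rightarrow> real) \<Rightarrow> bool" where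
  "weak_derivative l f g \<longleftrightarrow>
     f \<in> L2 (restrict_space lborel {0..l}) \<and> g \<in> L2 (restrict_space lborel {0..l}) \<and>
     (\<forall>\<phi> K. \<phi> C1_differentiable_on UNIV \<and> compact K \<and> K \<subseteq> {0<..<l} \<and> (\<forall>t. t \<notin> K \<longrightarrow> \<phi> t = 0) \<longrightarrow>
        (LBINT t:{0..l}. f t * deriv \<phi> t) = - (LBINT t:{0..l}. g t * \<phi> t))"

definition second_weak_derivative :: "real \<Rightarrow> (real \<Rightarrow> real) \<Rightarrow> (real \<Rightarrow> real) \<Rightarrow> bool" where
  "second_weak_derivative l f h \<longleftrightarrow> (\<exists>g. weak_derivative l f g \<and> weak_derivative l g h)"

definition graph_H2 :: "('v, 'e) pre_digraph \<Rightarrow> ('e \<Rightarrow> real) \<Rightarrow> ('e point \<Rightarrow> real) set" where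
  "graph_H2 G len = {f. \<forall>e\<in>arcs G. \<exists>h. second_weak_derivative (len e) (\<lambda>t. f (e, t)) h}"

text \<open>
  A function in \<open>H\<^sup>2\<close> that is continuous on the closed edge is continuously differentiable there,
  so the (one-sided) derivatives at the endpoints exist.
\<close>

definition edge_deriv ::
  "('e \<Rightarrow> real) \<Rightarrow> ('e point \<Rightarrow> real) \<Rightarrow> 'e \<Rightarrow> real \<Rightarrow> real" where
  "edge_deriv len f e t = vector_derivative (\<lambda>s. f (e, s)) (at t within {0..len e})"

text \<open>A loop is both an outgoing and an incoming arc, so it contributes one term for each end.\<close>

definition kirchhoff_condition ::
  "('v, 'e) pre_digraph \<Rightarrow> ('e \<Rightarrow> real) \<Rightarrow> ('e point \<Rightarrow> real) \<Rightarrow> bool" where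
  "kirchhoff_condition G len f \<longleftrightarrow>
     (\<forall>v\<in>verts G. (\<Sum>e\<in>out_arcs G v. edge_deriv len f e 0)
                 + (\<Sum>e\<in>in_arcs G v. - edge_deriv len f e (len e)) = 0)"

definition laplacian_domain :: "('v, 'e) pre_digraph \<Rightarrow> ('e \<Rightarrow> real) \<Rightarrow> ('e point \<Rightarrow> real) set" where
  "laplacian_domain G len =
     {f \<in> graph_H2 G len. continuous_on_graph G len f \<and> kirchhoff_condition G len f}"

text \<open>
  Operators on \<open>L\<^sub>2\<close> are relations between representatives: \<open>kirchhoff_laplacian G len f g\<close> means
  that \<open>f\<close> is in the domain and \<open>g\<close> represents its image; \<open>g\<close> is determined up to null sets.
\<close>

definition kirchhoff_laplacian ::
  "('v, 'e) pre_digraph \<Rightarrow> ('e \<Rightarrow> real) \<Rightarrow> ('e point \<Rightarrow> real) \<Rightarrow> ('e point \<Rightarrow> real) \<Rightarrow> bool" where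
  "kirchhoff_laplacian G len f g \<longleftrightarrow>
     f \<in> laplacian_domain G len \<and>
     (\<forall>e\<in>arcs G. second_weak_derivative (len e) (\<lambda>t. f (e, t)) (\<lambda>t. g (e, t)))"

definition whittle_matern_op ::
  "real \<Rightarrow> ('v, 'e) pre_digraph \<Rightarrow> ('e \<Rightarrow> real) \<Rightarrow> ('e point \<Rightarrow> real) \<Rightarrow> ('e point \<Rightarrow> real) \<Rightarrow> bool"
where
  "whittle_matern_op \<kappa> G len f h \<longleftrightarrow>
     (\<exists>g. kirchhoff_laplacian G len f g \<and>
          (AE x in graph_measure G len. h x = \<kappa>\<^sup>2 * f x - g x))"


section \<open>Fractional powers\<close>

definition orthonormal_basis :: "'a measure \<Rightarrow> (nat \<Rightarrow> 'a \<Rightarrow> real) \<Rightarrow> bool" where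
  "orthonormal_basis \<mu> \<phi> \<longleftrightarrow>
     (\<forall>i. \<phi> i \<in> L2 \<mu>) \<and>
     (\<forall>i j. L2_inner \<mu> (\<phi> i) (\<phi> j) = (if i = j then 1 else 0)) \<and>
     (\<forall>f\<in>L2 \<mu>. L2_sums \<mu> (\<lambda>i x. L2_inner \<mu> f (\<phi> i) * \<phi> i x) f)"

definition eigenbasis ::
  "real \<Rightarrow> ('v, 'e) pre_digraph \<Rightarrow> ('e \<Rightarrow> real) \<Rightarrow> (nat \<Rightarrow> real) \<Rightarrow> (nat \<Rightarrow> 'e point \<Rightarrow> real) \<Rightarrow> bool"
where
  "eigenbasis \<kappa> G len lam \<phi> \<longleftrightarrow>
     orthonormal_basis (graph_measure G len) \<phi> \<and> 0 < lam 0 \<and> incseq lam \<and>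
     (\<forall>i. whittle_matern_op \<kappa> G len (\<phi> i) (\<lambda>x. lam i * \<phi> i x))"

text \<open>
  \<open>fractional_power \<kappa> G len \<beta> \<psi> g\<close>: \<open>\<psi>\<close> is in the domain of \<open>L\<^sup>\<beta>\<close> and \<open>g\<close> represents its image.
  The choice of the eigenbasis does not influence \<open>g\<close> up to null sets.
\<close>

definition fractional_power ::
  "real \<Rightarrow> ('v, 'e) pre_digraph \<Rightarrow> ('e \<Rightarrow> real) \<Rightarrow> real \<Rightarrow>
   ('e point \<Rightarrow> real) \<Rightarrow> ('e point \<Rightarrow> real) \<Rightarrow> bool" where
  "fractional_power \<kappa> G len \<beta> \<psi> g \<longleftrightarrow>
     \<psi> \<in> L2 (graph_measure G len) \<and> g \<in> L2 (graph_measure G len) \<and>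
     (\<exists>lam \<phi>. eigenbasis \<kappa> G len lam \<phi> \<and>
        L2_sums (graph_measure G len)
          (\<lambda>i x. lam i powr \<beta> * L2_inner (graph_measure G len) \<psi> (\<phi> i) * \<phi> i x) g)"


section \<open>White noise and the random field\<close>

text \<open>Degenerate (zero variance) Gaussian variables are included.\<close>

definition centered_gaussian :: "'w measure \<Rightarrow> ('w \<Rightarrow> real) \<Rightarrow> bool" where
  "centered_gaussian M X \<longleftrightarrow>
     X \<in> borel_measurable M \<and>
     ((AE \<omega> in M. X \<omega> = 0) \<or> (\<exists>\<sigma>>0. distributed M lborel X (normal_density 0 \<sigma>)))"

definition gaussian_white_noise ::
  "'w measure \<Rightarrow> 'a measure \<Rightarrow> (('a \<Rightarrow> real) \<Rightarrow> 'w \<Rightarrow> real) \<Rightarrow> bool" where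
  "gaussian_white_noise M \<mu> W \<longleftrightarrow>
     prob_space M \<and>
     (\<forall>S c. finite S \<and> S \<subseteq> L2 \<mu> \<longrightarrow> centered_gaussian M (\<lambda>\<omega>. \<Sum>h\<in>S. c h * W h \<omega>)) \<and>
     (\<forall>h\<in>L2 \<mu>. \<forall>g\<in>L2 \<mu>. (\<integral>\<omega>. W h \<omega> * W g \<omega> \<partial>M) = L2_inner \<mu> h g)"

text \<open>
  An \<open>L\<^sub>2\<close>-valued random variable is represented by a jointly measurable function, so that its
  pointwise values are random variables for almost every point.
\<close>

definition L2_random_variable ::
  "'w measure \<Rightarrow> 'a measure \<Rightarrow> ('w \<Rightarrow> 'a \<Rightarrow> real) \<Rightarrow> bool" where
  "L2_random_variable M \<mu> u \<longleftrightarrow>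
     (\<lambda>(\<omega>, x). u \<omega> x) \<in> borel_measurable (M \<Otimes>\<^sub>M \<mu>) \<and> (\<forall>\<omega>\<in>space M. u \<omega> \<in> L2 \<mu>)"

definition whittle_matern_solution ::
  "'w measure \<Rightarrow> (('e point \<Rightarrow> real) \<Rightarrow> 'w \<Rightarrow> real) \<Rightarrow> real \<Rightarrow> real \<Rightarrow> real \<Rightarrow>
   ('v, 'e) pre_digraph \<Rightarrow> ('e \<Rightarrow> real) \<Rightarrow> ('w \<Rightarrow> 'e point \<Rightarrow> real) \<Rightarrow> bool" where
  "whittle_matern_solution M W \<kappa> \<tau> \<alpha> G len u \<longleftrightarrow>
     L2_random_variable M (graph_measure G len) u \<and>
     (\<forall>\<psi>\<in>L2 (graph_measure G len).
        centered_gaussian M (\<lambda>\<omega>. L2_inner (graph_measure G len) (u \<omega>) \<psi>) \<and>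
        (\<exists>g. fractional_power \<kappa> G len (- \<alpha> / 2) \<psi> g \<and>
             (AE \<omega> in M. L2_inner (graph_measure G len) (u \<omega>) \<psi> = W (\<lambda>x. inverse \<tau> * g x) \<omega>)))"

definition covariance_fun ::
  "'w measure \<Rightarrow> ('w \<Rightarrow> 'a \<Rightarrow> real) \<Rightarrow> 'a \<Rightarrow> 'a \<Rightarrow> real" where
  "covariance_fun M u s s' = (\<integral>\<omega>. u \<omega> s * u \<omega> s' \<partial>M)"


section \<open>Removing a vertex of degree two\<close>

definition incident :: "('v, 'e) pre_digraph \<Rightarrow> 'e \<Rightarrow> 'v \<Rightarrow> bool" where
  "incident G e v \<longleftrightarrow> e \<in> arcs G \<and> (tail G e = v \<or> head G e = v)"

definition other_end :: "('v, 'e) pre_digraph \<Rightarrow> 'e \<Rightarrow> 'v \<Rightarrow> 'v" where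
  "other_end G e v = (if tail G e = v then head G e else tail G e)"

text \<open>
  The merged edge keeps the name \<open>k\<close>. It is parametrised from the far end of \<open>k\<close>, through the
  removed vertex \<open>v\<close> at coordinate \<open>len k\<close>, to the far end of \<open>l\<close>, irrespective of the directions
  of \<open>k\<close> and \<open>l\<close> in the original graph.
\<close>

definition merge_graph :: "('v, 'e) pre_digraph \<Rightarrow> 'v \<Rightarrow> 'e \<Rightarrow> 'e \<Rightarrow> ('v, 'e) pre_digraph" where
  "merge_graph G v k l =
     \<lparr>verts = verts G - {v}, arcs = arcs G - {l},
      tail = (tail G)(k := other_end G k v), head = (head G)(k := other_end G l v)\<rparr>"

definition merge_len :: "('e \<Rightarrow> real) \<Rightarrow> 'e \<Rightarrow> 'e \<Rightarrow> 'e \<Rightarrow> real" where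
  "merge_len len k l = len(k := len k + len l)"

definition merge_point ::
  "('v, 'e) pre_digraph \<Rightarrow> ('e \<Rightarrow> real) \<Rightarrow> 'v \<Rightarrow> 'e \<Rightarrow> 'e \<Rightarrow> 'e point \<Rightarrow> 'e point" where
  "merge_point G len v k l = (\<lambda>(e, t).
     if e = k then (k, if head G k = v then t else len k - t)
     else if e = l then (k, len k + (if tail G l = v then t else len l - t))
     else (e, t))"

end

theory Submission
  imports Defs
begin

text \<open>
  Merging the two edges at a vertex of degree two does not change the operator \<open>L\<close>. Identify the
  points of the two graphs by the map \<open>\<iota>\<close>, which preserves measure and is invertible up to a null
  set. At the removed vertex continuity together with the Kirchhoff condition says that value and
  derivative match across the vertex, which an \<open>H\<^sup>2\<close> function on the merged edge satisfies anyway.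
  So the spectral decompositions of the two operators correspond under \<open>\<iota>\<close>, and with them the
  operators \<open>\<tau>\<^sup>-\<^sup>2 L\<^sup>-\<^sup>\<alpha>\<close>, whose kernels are the covariance functions.

  The equality of operators is not proved as such. It suffices that an eigenfunction of one graph is
  orthogonal to the pulled back eigenfunctions of the other graph whenever the eigenvalues differ
  (\<open>eigenvectors_orthogonal\<close>). Then the matrix \<open>a i j\<close> between the two eigenbases satisfies
  \<open>F (lam i) * a i j = F (lam' j) * a i j\<close> for every function \<open>F\<close>, so \<open>F L\<close> computed with either basis
  gives the same vector (\<open>spectral_functions_correspond\<close>); in particular the choice of the
  eigenbasis in the definition of a fractional power is harmless. Orthogonality is Green's identity.
  Since the right hand side of the weak equation \<open>f'' = (\<kappa>\<^sup>2 - a) f\<close> is continuous, the du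
  Bois-Reymond lemma makes \<open>f\<close> a classical solution on each closed edge
  (\<open>weak_eigenfunction_is_classical\<close>); pulling such solutions back to the shorter edges is the chain
  rule (\<open>classical_eigenfunction_pullback\<close>), and the boundary terms in Green's identity cancel by the
  Kirchhoff condition.

  It remains to pass from the bilinear form \<open>E[(u,\<psi>)(u,\<chi>)]\<close> to pointwise covariances. By Fubini the
  form determines the covariance function almost everywhere (\<open>second_moment_kernel\<close>,
  \<open>AE_eq_if_rectangle_integrals_eq\<close>) as soon as \<open>E \<parallel>u\<parallel>\<^sup>2\<close> is finite. Weyl asymptotics of the
  eigenvalues would give this for \<open>\<alpha> > 1/2\<close>; here it follows from the mere existence of the
  Gaussian element \<open>u\<close> with values in \<open>L\<^sub>2\<close>, because a convergent series of squares of Gaussian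
  variables has an integrable sum (\<open>sum_gaussian_squares_integrable\<close>).
\<close>

section \<open>Square integrable functions\<close>

lemma L2_measurable: "f \<in> L2 \<mu> \<Longrightarrow> f \<in> borel_measurable \<mu>"
  by (simp add: L2_def)

lemma L2_integrable_mult:
  assumes "f \<in> L2 \<mu>" "g \<in> L2 \<mu>"
  shows "integrable \<mu> (\<lambda>x. f x * g x)"
proof (rule Bochner_Integration.integrable_bound)
  show "integrable \<mu> (\<lambda>x. (f x)\<^sup>2 + (g x)\<^sup>2)"
    using assms by (auto simp: L2_def)
  show "(\<lambda>x. f x * g x) \<in> borel_measurable \<mu>"
    using assms by (auto simp: L2_def)
  have "\<bar>a * b\<bar> \<le> a\<^sup>2 + b\<^sup>2" for a b :: real
    using sum_squares_bound[of "\<bar>a\<bar>" "\<bar>b\<bar>"] mult_nonneg_nonneg[of "\<bar>a\<bar>" "\<bar>b\<bar>"]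
    unfolding abs_mult by (simp only: power2_abs) linarith
  then show "AE x in \<mu>. norm (f x * g x) \<le> norm ((f x)\<^sup>2 + (g x)\<^sup>2)"
    by simp
qed

lemma L2_scale: "f \<in> L2 \<mu> \<Longrightarrow> (\<lambda>x. c * f x) \<in> L2 \<mu>"
  by (auto simp: L2_def power_mult_distrib)

lemma L2_add:
  assumes "f \<in> L2 \<mu>" "g \<in> L2 \<mu>"
  shows "(\<lambda>x. f x + g x) \<in> L2 \<mu>"
  using assms L2_integrable_mult[OF assms]
  by (auto simp: L2_def power2_sum mult.assoc)

lemma L2_diff:
  assumes "f \<in> L2 \<mu>" "g \<in> L2 \<mu>"
  shows "(\<lambda>x. f x - g x) \<in> L2 \<mu>"
  using L2_add[OF assms(1) L2_scale[OF assms(2), of "-1"]] by simp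

lemma L2_zero: "(\<lambda>x. 0) \<in> L2 \<mu>"
  by (simp add: L2_def)

lemma L2_sum: "(\<And>i. i \<in> I \<Longrightarrow> f i \<in> L2 \<mu>) \<Longrightarrow> (\<lambda>x. \<Sum>i\<in>I. f i x) \<in> L2 \<mu>"
  by (induction I rule: infinite_finite_induct) (auto intro: L2_add L2_zero)

lemma L2_inner_commute: "L2_inner \<mu> f g = L2_inner \<mu> g f"
  by (simp add: L2_inner_def mult.commute)

lemma L2_inner_scale: "L2_inner \<mu> (\<lambda>x. c * f x) g = c * L2_inner \<mu> f g"
  by (simp add: L2_inner_def mult.assoc)

lemma L2_inner_diff:
  assumes "f \<in> L2 \<mu>" "g \<in> L2 \<mu>" "h \<in> L2 \<mu>"
  shows "L2_inner \<mu> (\<lambda>x. f x - g x) h = L2_inner \<mu> f h - L2_inner \<mu> g h"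
  using assms by (simp add: L2_inner_def left_diff_distrib L2_integrable_mult)

lemma L2_inner_sum:
  assumes "\<And>i. i \<in> I \<Longrightarrow> f i \<in> L2 \<mu>" "h \<in> L2 \<mu>"
  shows "L2_inner \<mu> (\<lambda>x. \<Sum>i\<in>I. f i x) h = (\<Sum>i\<in>I. L2_inner \<mu> (f i) h)"
  using assms by (simp add: L2_inner_def sum_distrib_right L2_integrable_mult)

lemma L2_inner_self_nonneg: "0 \<le> L2_inner \<mu> f f"
  by (simp add: L2_inner_def)

lemma L2_norm_power2: "(L2_norm \<mu> f)\<^sup>2 = L2_inner \<mu> f f"
  by (simp add: L2_norm_def L2_inner_self_nonneg)

lemma L2_inner_cong_AE:
  assumes "f \<in> borel_measurable \<mu>" "f' \<in> borel_measurable \<mu>" "g \<in> borel_measurable \<mu>"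
    and "AE x in \<mu>. f x = f' x"
  shows "L2_inner \<mu> f g = L2_inner \<mu> f' g"
  unfolding L2_inner_def using assms by (intro integral_cong_AE) auto

lemma L2_Cauchy_Schwarz:
  assumes f: "f \<in> L2 \<mu>" and g: "g \<in> L2 \<mu>"
  shows "\<bar>L2_inner \<mu> f g\<bar> \<le> L2_norm \<mu> f * L2_norm \<mu> g"
proof -
  let ?a = "L2_inner \<mu> f f" and ?b = "L2_inner \<mu> f g" and ?c = "L2_inner \<mu> g g"
  have quad: "0 \<le> ?a - 2 * t * ?b + t\<^sup>2 * ?c" for t
  proof -
    have tg: "(\<lambda>x. t * g x) \<in> L2 \<mu>" using g by (rule L2_scale)
    note d = L2_diff[OF f tg]
    have "L2_inner \<mu> (\<lambda>x. f x - t * g x) (\<lambda>x. f x - t * g x)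
        = L2_inner \<mu> f (\<lambda>x. f x - t * g x) - t * L2_inner \<mu> g (\<lambda>x. f x - t * g x)"
      using f tg d by (simp add: L2_inner_diff L2_inner_scale)
    also have "\<dots> = (?a - t * ?b) - t * (?b - t * ?c)"
      using L2_inner_diff[OF f tg f] L2_inner_diff[OF f tg g]
      by (simp add: L2_inner_scale L2_inner_commute[of \<mu> f "\<lambda>x. f x - t * g x"]
          L2_inner_commute[of \<mu> g "\<lambda>x. f x - t * g x"] L2_inner_commute[of \<mu> g f])
    finally show ?thesis
      using L2_inner_self_nonneg[of \<mu> "\<lambda>x. f x - t * g x"] by (simp add: algebra_simps power2_eq_square)
  qed
  have "?b\<^sup>2 \<le> ?a * ?c"
  proof (cases "?c = 0")
    case True
    have "?b = 0"
    proof (rule ccontr)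
      assume "?b \<noteq> 0"
      with quad[of "(?a + 1) / (2 * ?b)"] True show False by (simp add: field_simps)
    qed
    with True show ?thesis by simp
  next
    case False
    then have "0 < ?c" using L2_inner_self_nonneg[of \<mu> g] by simp
    then show ?thesis using quad[of "?b / ?c"] by (simp add: field_simps power2_eq_square)
  qed
  then have "sqrt (?b\<^sup>2) \<le> sqrt (?a * ?c)" by (rule real_sqrt_le_mono)
  then show ?thesis by (simp add: L2_norm_def real_sqrt_mult)
qed

lemma L2_sums_inner:
  assumes sums: "L2_sums \<mu> f g" and f: "\<And>i. f i \<in> L2 \<mu>" and g: "g \<in> L2 \<mu>" and h: "h \<in> L2 \<mu>"
  shows "(\<lambda>i. L2_inner \<mu> (f i) h) sums L2_inner \<mu> g h"
proof -
  have "(\<lambda>n. L2_inner \<mu> g h - (\<Sum>i<n. L2_inner \<mu> (f i) h)) \<longlonglongrightarrow> 0"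
  proof (rule Lim_null_comparison)
    show "(\<lambda>n. L2_norm \<mu> (\<lambda>x. g x - (\<Sum>i<n. f i x)) * L2_norm \<mu> h) \<longlonglongrightarrow> 0"
      using tendsto_mult_right[OF sums[unfolded L2_sums_def], of "L2_norm \<mu> h"] by simp
    have "\<bar>L2_inner \<mu> g h - (\<Sum>i<n. L2_inner \<mu> (f i) h)\<bar>
        \<le> L2_norm \<mu> (\<lambda>x. g x - (\<Sum>i<n. f i x)) * L2_norm \<mu> h" for n
      using L2_Cauchy_Schwarz[OF L2_diff[OF g L2_sum[of "{..<n}" f]] h] f g h
      by (simp add: L2_inner_diff L2_inner_sum L2_sum)
    then show "\<forall>\<^sub>F n in sequentially. norm (L2_inner \<mu> g h - (\<Sum>i<n. L2_inner \<mu> (f i) h))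
        \<le> L2_norm \<mu> (\<lambda>x. g x - (\<Sum>i<n. f i x)) * L2_norm \<mu> h" by simp
  qed
  from tendsto_diff[OF tendsto_const[of "L2_inner \<mu> g h"] this] show ?thesis
    by (simp add: sums_def)
qed

lemma L2_norm_zero_AE:
  assumes "f \<in> L2 \<mu>" "L2_norm \<mu> f = 0"
  shows "AE x in \<mu>. f x = 0"
proof -
  have "(\<integral>x. (f x)\<^sup>2 \<partial>\<mu>) = 0"
    using assms(2) L2_norm_power2[of \<mu> f] by (simp add: L2_inner_def power2_eq_square)
  then show ?thesis
    using assms(1) by (subst (asm) integral_nonneg_eq_0_iff_AE) (auto simp: L2_def)
qed

lemma orthonormal_basis_separates:
  assumes basis: "orthonormal_basis \<mu> \<phi>" and f: "f \<in> L2 \<mu>" and g: "g \<in> L2 \<mu>"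
    and coeff: "\<And>i. L2_inner \<mu> f (\<phi> i) = L2_inner \<mu> g (\<phi> i)"
  shows "AE x in \<mu>. f x = g x"
proof -
  have \<phi>: "\<phi> i \<in> L2 \<mu>" for i using basis by (simp add: orthonormal_basis_def)
  note d = L2_diff[OF f g]
  have "L2_inner \<mu> (\<lambda>x. f x - g x) (\<phi> i) = 0" for i
    using L2_inner_diff[OF f g \<phi>] coeff by simp
  moreover have "L2_sums \<mu> (\<lambda>i x. L2_inner \<mu> (\<lambda>x. f x - g x) (\<phi> i) * \<phi> i x) (\<lambda>x. f x - g x)"
    using basis d by (simp add: orthonormal_basis_def)
  ultimately have "L2_norm \<mu> (\<lambda>x. f x - g x) = 0"
    by (simp add: L2_sums_def LIMSEQ_const_iff)
  from L2_norm_zero_AE[OF d this] show ?thesis by simp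
qed

lemma orthonormal_basis_Parseval:
  assumes basis: "orthonormal_basis \<mu> \<phi>" and f: "f \<in> L2 \<mu>"
  shows "(\<lambda>i. (L2_inner \<mu> f (\<phi> i))\<^sup>2) sums L2_inner \<mu> f f"
proof -
  have \<phi>: "\<phi> i \<in> L2 \<mu>" for i using basis by (simp add: orthonormal_basis_def)
  have "L2_sums \<mu> (\<lambda>i x. L2_inner \<mu> f (\<phi> i) * \<phi> i x) f"
    using basis f by (simp add: orthonormal_basis_def)
  from L2_sums_inner[OF this L2_scale[OF \<phi>] f f] show ?thesis
    by (simp only: L2_inner_scale L2_inner_commute[of \<mu> "\<phi> _" f] power2_eq_square)
qed

lemma
  assumes \<iota>: "\<iota> \<in> measurable \<mu> \<mu>'" and distr: "distr \<mu> \<mu>' \<iota> = \<mu>'"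
  shows L2_pullback: "f \<in> L2 \<mu>' \<Longrightarrow> (\<lambda>x. f (\<iota> x)) \<in> L2 \<mu>"
    and L2_inner_pullback: "f \<in> L2 \<mu>' \<Longrightarrow> g \<in> L2 \<mu>' \<Longrightarrow>
      L2_inner \<mu> (\<lambda>x. f (\<iota> x)) (\<lambda>x. g (\<iota> x)) = L2_inner \<mu>' f g"
proof -
  show "(\<lambda>x. f (\<iota> x)) \<in> L2 \<mu>" if "f \<in> L2 \<mu>'"
  proof -
    have "f \<in> borel_measurable \<mu>'" "integrable (distr \<mu> \<mu>' \<iota>) (\<lambda>x. (f x)\<^sup>2)"
      using that distr by (auto simp: L2_def)
    then show ?thesis
      using \<iota> integrable_distr[OF \<iota>, of "\<lambda>x. (f x)\<^sup>2"] measurable_compose[OF \<iota>, of f borel]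
      by (auto simp: L2_def)
  qed
  show "L2_inner \<mu> (\<lambda>x. f (\<iota> x)) (\<lambda>x. g (\<iota> x)) = L2_inner \<mu>' f g" if "f \<in> L2 \<mu>'" "g \<in> L2 \<mu>'"
    using integral_distr[OF \<iota>, of "\<lambda>x. f x * g x"] that distr
    by (auto simp: L2_inner_def L2_def)
qed

lemma L2_sums_pullback:
  assumes \<iota>: "\<iota> \<in> measurable \<mu> \<mu>'" and distr: "distr \<mu> \<mu>' \<iota> = \<mu>'"
    and sums: "L2_sums \<mu>' f g" and f: "\<And>i. f i \<in> L2 \<mu>'" and g: "g \<in> L2 \<mu>'"
  shows "L2_sums \<mu> (\<lambda>i x. f i (\<iota> x)) (\<lambda>x. g (\<iota> x))"
proof -
  have "L2_norm \<mu> (\<lambda>x. g (\<iota> x) - (\<Sum>i<n. f i (\<iota> x))) = L2_norm \<mu>' (\<lambda>x. g x - (\<Sum>i<n. f i x))" for n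
    using L2_inner_pullback[OF \<iota> distr L2_diff[OF g L2_sum] L2_diff[OF g L2_sum], of "{..<n}" f "{..<n}" f] f
    by (simp add: L2_norm_def)
  then show ?thesis using sums by (simp add: L2_sums_def)
qed

text \<open>
  Both sides are compared by their coefficients in the basis \<open>\<phi>\<close>. With
  \<open>a i j = (\<phi> i, \<phi>' j \<circ> \<iota>)\<close>, the coefficient of \<open>g' \<circ> \<iota>\<close> is
  \<open>\<Sum>j. F (lam' j) * (\<psi>', \<phi>' j) * a i j\<close>. Wherever \<open>a i j\<close> does not vanish, \<open>lam' j\<close> equals \<open>lam i\<close>, so
  \<open>F (lam i)\<close> can be taken out of the sum, and what remains is the expansion of \<open>\<psi>' \<circ> \<iota>\<close>.
\<close>

lemma spectral_functions_correspond:
  fixes F :: "real \<Rightarrow> real"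
  assumes \<iota>: "\<iota> \<in> measurable \<mu> \<mu>'" and distr: "distr \<mu> \<mu>' \<iota> = \<mu>'"
    and basis: "orthonormal_basis \<mu> \<phi>" and basis': "orthonormal_basis \<mu>' \<phi>'"
    and orth: "\<And>i j. lam i \<noteq> lam' j \<Longrightarrow> L2_inner \<mu> (\<phi> i) (\<lambda>x. \<phi>' j (\<iota> x)) = 0"
    and \<psi>: "\<psi> \<in> L2 \<mu>" and \<psi>': "\<psi>' \<in> L2 \<mu>'" and \<psi>_eq: "AE x in \<mu>. \<psi> x = \<psi>' (\<iota> x)"
    and g: "g \<in> L2 \<mu>" and g': "g' \<in> L2 \<mu>'"
    and g_sum: "L2_sums \<mu> (\<lambda>i x. F (lam i) * L2_inner \<mu> \<psi> (\<phi> i) * \<phi> i x) g"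
    and g'_sum: "L2_sums \<mu>' (\<lambda>j x. F (lam' j) * L2_inner \<mu>' \<psi>' (\<phi>' j) * \<phi>' j x) g'"
  shows "AE x in \<mu>. g x = g' (\<iota> x)"
proof (rule orthonormal_basis_separates[OF basis g L2_pullback[OF \<iota> distr g']])
  fix i
  have \<phi>: "\<phi> i \<in> L2 \<mu>" for i using basis by (simp add: orthonormal_basis_def)
  have \<phi>': "\<phi>' j \<in> L2 \<mu>'" for j using basis' by (simp add: orthonormal_basis_def)
  have on: "L2_inner \<mu> (\<phi> j) (\<phi> i) = (if j = i then 1 else 0)" for j
    using basis by (simp add: orthonormal_basis_def)
  let ?a = "\<lambda>j. L2_inner \<mu> (\<lambda>x. \<phi>' j (\<iota> x)) (\<phi> i)"
  have "(\<lambda>j. (F (lam j) * L2_inner \<mu> \<psi> (\<phi> j)) * L2_inner \<mu> (\<phi> j) (\<phi> i)) sums L2_inner \<mu> g (\<phi> i)"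
    using L2_sums_inner[OF g_sum L2_scale[OF \<phi>] g \<phi>, of i] by (simp add: L2_inner_scale)
  moreover have "(F (lam j) * L2_inner \<mu> \<psi> (\<phi> j)) * L2_inner \<mu> (\<phi> j) (\<phi> i)
      = (if j = i then F (lam j) * L2_inner \<mu> \<psi> (\<phi> j) else 0)" for j
    by (simp add: on)
  ultimately have lhs: "L2_inner \<mu> g (\<phi> i) = F (lam i) * L2_inner \<mu> \<psi> (\<phi> i)"
    using sums_single[of i "\<lambda>j. F (lam j) * L2_inner \<mu> \<psi> (\<phi> j)"] sums_unique2 by (simp only:) blast
  have "L2_sums \<mu>' (\<lambda>j x. L2_inner \<mu>' \<psi>' (\<phi>' j) * \<phi>' j x) \<psi>'"
    using basis' \<psi>' by (simp add: orthonormal_basis_def)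
  from L2_sums_inner[OF L2_sums_pullback[OF \<iota> distr this L2_scale[OF \<phi>'] \<psi>']
      L2_pullback[OF \<iota> distr L2_scale[OF \<phi>']] L2_pullback[OF \<iota> distr \<psi>'] \<phi>, of i]
  have "(\<lambda>j. L2_inner \<mu>' \<psi>' (\<phi>' j) * ?a j) sums L2_inner \<mu> (\<lambda>x. \<psi>' (\<iota> x)) (\<phi> i)"
    by (simp add: L2_inner_scale)
  then have "(\<lambda>j. F (lam i) * (L2_inner \<mu>' \<psi>' (\<phi>' j) * ?a j))
      sums (F (lam i) * L2_inner \<mu> (\<lambda>x. \<psi>' (\<iota> x)) (\<phi> i))"
    by (rule sums_mult)
  moreover
  from L2_sums_inner[OF L2_sums_pullback[OF \<iota> distr g'_sum L2_scale[OF \<phi>'] g']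
      L2_pullback[OF \<iota> distr L2_scale[OF \<phi>']] L2_pullback[OF \<iota> distr g'] \<phi>, of i]
  have "(\<lambda>j. F (lam' j) * L2_inner \<mu>' \<psi>' (\<phi>' j) * ?a j) sums L2_inner \<mu> (\<lambda>x. g' (\<iota> x)) (\<phi> i)"
    by (simp add: L2_inner_scale)
  moreover have "F (lam' j) * L2_inner \<mu>' \<psi>' (\<phi>' j) * ?a j = F (lam i) * (L2_inner \<mu>' \<psi>' (\<phi>' j) * ?a j)" for j
    using orth[of i j] L2_inner_commute[of \<mu> "\<phi> i" "\<lambda>x. \<phi>' j (\<iota> x)"] by (cases "lam i = lam' j") auto
  ultimately have rhs: "L2_inner \<mu> (\<lambda>x. g' (\<iota> x)) (\<phi> i) = F (lam i) * L2_inner \<mu> (\<lambda>x. \<psi>' (\<iota> x)) (\<phi> i)"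
    by (simp add: sums_unique2)
  have "L2_inner \<mu> \<psi> (\<phi> i) = L2_inner \<mu> (\<lambda>x. \<psi>' (\<iota> x)) (\<phi> i)"
    using \<psi>_eq L2_measurable[OF \<psi>] L2_measurable[OF L2_pullback[OF \<iota> distr \<psi>']] L2_measurable[OF \<phi>]
    by (intro L2_inner_cong_AE)
  with lhs rhs show "L2_inner \<mu> g (\<phi> i) = L2_inner \<mu> (\<lambda>x. g' (\<iota> x)) (\<phi> i)" by simp
qed

lemma L2_bounded:
  assumes "finite_measure \<mu>" "f \<in> borel_measurable \<mu>" "\<And>x. \<bar>f x\<bar> \<le> 1"
  shows "f \<in> L2 \<mu>"
proof -
  have "integrable \<mu> (\<lambda>x. (f x)\<^sup>2)"
    by (rule finite_measure.integrable_const_bound[OF assms(1), where B = 1])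
      (use assms(2,3) in \<open>auto simp: abs_square_le_1\<close>)
  then show ?thesis using assms(2) by (simp add: L2_def)
qed

section \<open>Gaussian random elements have finite second moment\<close>

lemma (in prob_space) centered_gaussian_moments:
  assumes X: "centered_gaussian M X"
  shows "integrable M (\<lambda>\<omega>. (X \<omega>)\<^sup>2)" and "integrable M (\<lambda>\<omega>. (X \<omega>) ^ 4)"
    and "expectation (\<lambda>\<omega>. (X \<omega>) ^ 4) = 3 * (expectation (\<lambda>\<omega>. (X \<omega>)\<^sup>2))\<^sup>2"
proof -
  have X_meas: "X \<in> borel_measurable M" using X by (simp add: centered_gaussian_def)
  have "integrable M (\<lambda>\<omega>. (X \<omega>)\<^sup>2) \<and> integrable M (\<lambda>\<omega>. (X \<omega>) ^ 4) \<and>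
    expectation (\<lambda>\<omega>. (X \<omega>) ^ 4) = 3 * (expectation (\<lambda>\<omega>. (X \<omega>)\<^sup>2))\<^sup>2"
  proof (cases "AE \<omega> in M. X \<omega> = 0")
    case True
    have zero: "integrable M (\<lambda>\<omega>. (X \<omega>) ^ n) \<and> expectation (\<lambda>\<omega>. (X \<omega>) ^ n) = 0" if "0 < n" for n
    proof -
      have ae: "AE \<omega> in M. (X \<omega>) ^ n = 0"
        using True by eventually_elim (use that in simp)
      have "integrable M (\<lambda>\<omega>. (X \<omega>) ^ n) \<longleftrightarrow> integrable M (\<lambda>\<omega>. 0::real)"
        by (rule integrable_cong_AE) (use ae X_meas in auto)
      moreover have "expectation (\<lambda>\<omega>. (X \<omega>) ^ n) = 0"
        using ae by (rule integral_eq_zero_AE)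
      ultimately show ?thesis by simp
    qed
    show ?thesis using zero[of 2] zero[of 4] by simp
  next
    case False
    then obtain \<sigma> where \<sigma>: "0 < \<sigma>" and D: "distributed M lborel X (normal_density 0 \<sigma>)"
      using X by (auto simp: centered_gaussian_def)
    have moment: "has_bochner_integral lborel (\<lambda>x. normal_density 0 \<sigma> x * x ^ (2 * k))
        (fact (2 * k) / ((2 / \<sigma>\<^sup>2) ^ k * fact k))" for k
      using normal_moment_even[OF \<sigma>, of 0 k] by simp
    have X_moment: "integrable M (\<lambda>\<omega>. (X \<omega>) ^ (2 * k)) \<and>
        expectation (\<lambda>\<omega>. (X \<omega>) ^ (2 * k)) = fact (2 * k) / ((2 / \<sigma>\<^sup>2) ^ k * fact k)" for k
      using distributed_integrable[OF D, of "\<lambda>x. x ^ (2 * k)"]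
        distributed_integral[OF D, of "\<lambda>x. x ^ (2 * k)"]
        integrable.intros[OF moment, of k] has_bochner_integral_integral_eq[OF moment, of k] by simp
    show ?thesis
      using X_moment[of 1] X_moment[of 2] \<sigma> by (simp add: fact_numeral power2_eq_square field_simps)
  qed
  then show "integrable M (\<lambda>\<omega>. (X \<omega>)\<^sup>2)" and "integrable M (\<lambda>\<omega>. (X \<omega>) ^ 4)"
    and "expectation (\<lambda>\<omega>. (X \<omega>) ^ 4) = 3 * (expectation (\<lambda>\<omega>. (X \<omega>)\<^sup>2))\<^sup>2" by auto
qed

text \<open>
  The fourth moment of a centered Gaussian variable is three times the square of its variance, so
  Cauchy-Schwarz with weights \<open>w\<close> bounds the second moment of the sum of squares by the squared
  total weight, up to the factor 3 and without any independence. Weights above the variances, instead of the variances themselves, keep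
  the division by \<open>w i\<close> meaningful for degenerate variables.
\<close>

lemma (in prob_space) sum_gaussian_squares_second_moment:
  assumes X: "\<And>i. centered_gaussian M (X i)"
    and w: "\<And>i. expectation (\<lambda>\<omega>. (X i \<omega>)\<^sup>2) \<le> w i" "\<And>i. 0 < w i"
  shows "integrable M (\<lambda>\<omega>. (\<Sum>i<n. (X i \<omega>)\<^sup>2)\<^sup>2)"
    and "expectation (\<lambda>\<omega>. (\<Sum>i<n. (X i \<omega>)\<^sup>2)\<^sup>2) \<le> 3 * (\<Sum>i<n. w i)\<^sup>2"
proof -
  let ?T = "\<lambda>\<omega>. (\<Sum>i<n. (X i \<omega>)\<^sup>2)" and ?W = "\<Sum>i<n. w i"
  have [measurable]: "X i \<in> borel_measurable M" for i using X by (simp add: centered_gaussian_def)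
  note mom = centered_gaussian_moments[OF X]
  let ?B = "\<lambda>\<omega>. ?W * (\<Sum>i<n. (X i \<omega>) ^ 4 / w i)"
  have bound: "(?T \<omega>)\<^sup>2 \<le> ?B \<omega>" for \<omega>
  proof -
    have "(\<Sum>i<n. sqrt (w i) * ((X i \<omega>)\<^sup>2 / sqrt (w i)))\<^sup>2
        \<le> (\<Sum>i<n. (sqrt (w i))\<^sup>2) * (\<Sum>i<n. ((X i \<omega>)\<^sup>2 / sqrt (w i))\<^sup>2)"
      by (rule Cauchy_Schwarz_ineq_sum)
    moreover have "sqrt (w i) * ((X i \<omega>)\<^sup>2 / sqrt (w i)) = (X i \<omega>)\<^sup>2" "(sqrt (w i))\<^sup>2 = w i"
      "((X i \<omega>)\<^sup>2 / sqrt (w i))\<^sup>2 = (X i \<omega>) ^ 4 / w i" for i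
      using w(2)[of i] by (simp_all add: power_divide less_imp_le)
    ultimately show ?thesis by simp
  qed
  have B: "integrable M ?B" using mom(2) by simp
  show T: "integrable M (\<lambda>\<omega>. (?T \<omega>)\<^sup>2)"
    by (rule Bochner_Integration.integrable_bound[OF B]) (use bound in \<open>auto intro: order_trans[OF _ abs_ge_self]\<close>)
  have "expectation (\<lambda>\<omega>. (?T \<omega>)\<^sup>2) \<le> expectation ?B"
    by (rule integral_mono[OF T B bound])
  also have "\<dots> = ?W * (\<Sum>i<n. 3 * (expectation (\<lambda>\<omega>. (X i \<omega>)\<^sup>2))\<^sup>2 / w i)"
    using mom(2) by (simp add: mom(3))
  also have "\<dots> \<le> ?W * (\<Sum>i<n. 3 * w i)"
  proof (intro mult_left_mono sum_mono sum_nonneg less_imp_le[OF w(2)])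
    fix i
    have "(expectation (\<lambda>\<omega>. (X i \<omega>)\<^sup>2))\<^sup>2 \<le> (w i)\<^sup>2"
      using w(1) by (intro power_mono) auto
    then show "3 * (expectation (\<lambda>\<omega>. (X i \<omega>)\<^sup>2))\<^sup>2 / w i \<le> 3 * w i"
      using w(2)[of i] by (simp add: divide_le_eq power2_eq_square)
  qed
  also have "\<dots> = 3 * ?W\<^sup>2" by (simp add: sum_distrib_left[symmetric] power2_eq_square)
  finally show "expectation (\<lambda>\<omega>. (?T \<omega>)\<^sup>2) \<le> 3 * ?W\<^sup>2" .
qed

text \<open>
  A weak form of Fernique's theorem. Let \<open>T n\<close> be the partial sums. By the preceding bound
  the second moment of \<open>T n\<close> is of the order of its squared mean, up to constants, so a fixed proportion of the mass of \<open>T n\<close> cannot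
  sit on an event of small probability. As \<open>S\<close> is finite everywhere, the event \<open>S > K\<close> has small
  probability for some \<open>K\<close>, and outside of it \<open>T n \<le> K\<close>. Hence \<open>E (T n)\<close> is bounded uniformly in \<open>n\<close>.
\<close>

lemma (in prob_space) sum_gaussian_squares_integrable:
  assumes X: "\<And>i. centered_gaussian M (X i)"
    and S: "\<And>\<omega>. \<omega> \<in> space M \<Longrightarrow> (\<lambda>i. (X i \<omega>)\<^sup>2) sums S \<omega>"
  shows "integrable M S"
proof -
  let ?T = "\<lambda>n \<omega>. (\<Sum>i<n. (X i \<omega>)\<^sup>2)"
  define s where "s i = expectation (\<lambda>\<omega>. (X i \<omega>)\<^sup>2)" for i
  have X_meas[measurable]: "X i \<in> borel_measurable M" for i using X by (simp add: centered_gaussian_def)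
  have Tint: "integrable M (?T n)" and ET: "expectation (?T n) = (\<Sum>i<n. s i)" for n
    using centered_gaussian_moments(1)[OF X] by (simp_all add: s_def)
  have s_nonneg: "0 \<le> s i" for i by (simp add: s_def)
  have S_meas[measurable]: "S \<in> borel_measurable M"
    by (rule borel_measurable_LIMSEQ_real[of M ?T]) (use S in \<open>auto simp: sums_def\<close>)
  have T_le: "?T n \<omega> \<le> S \<omega>" if "\<omega> \<in> space M" for n \<omega>
    using S[OF that] sum_le_suminf[OF sums_summable[OF S[OF that]], of "{..<n}"]
      sums_unique[OF S[OF that]] by simp
  obtain K :: nat where K: "prob {\<omega> \<in> space M. real K < S \<omega>} \<le> 1 / 12"
  proof -
    have "(\<lambda>n. prob {\<omega> \<in> space M. real n < S \<omega>}) \<longlonglongrightarrow> prob (\<Inter>n. {\<omega> \<in> space M. real n < S \<omega>})"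
      by (rule finite_Lim_measure_decseq) (auto simp: decseq_def)
    moreover have "(\<Inter>n. {\<omega> \<in> space M. real n < S \<omega>}) = {}"
    proof -
      have "\<exists>n. \<not> real n < S \<omega>" for \<omega>
        using reals_Archimedean2[of "S \<omega>"] less_asym by blast
      then show ?thesis by blast
    qed
    ultimately have "(\<lambda>n. prob {\<omega> \<in> space M. real n < S \<omega>}) \<longlonglongrightarrow> 0" by simp
    then have "\<forall>\<^sub>F n in sequentially. prob {\<omega> \<in> space M. real n < S \<omega>} < 1 / 12"
      by (rule order_tendstoD) simp
    then show ?thesis
      using that by (auto simp: eventually_sequentially intro: less_imp_le)
  qed
  define A where "A = {\<omega> \<in> space M. real K < S \<omega>}"
  have A: "A \<in> events" "prob A \<le> 1 / 12" using K by (auto simp: A_def)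
  have bounded: "(\<Sum>i<n. s i) \<le> 2 * real K + 3" for n
  proof -
    \<comment> \<open>The summable excess makes the weights positive and costs a bounded amount only.\<close>
    define w where "w i = s i + (1/2) ^ i" for i
    have w_pos: "0 < w i" for i using s_nonneg[of i] by (simp add: w_def add_nonneg_pos)
    have "(\<Sum>i<n. (1/2::real) ^ i) \<le> 2"
      using sum_le_suminf[OF summable_geometric[of "1/2::real"], of "{..<n}"] suminf_geometric[of "1/2::real"]
      by simp
    then have W: "(\<Sum>i<n. w i) \<le> (\<Sum>i<n. s i) + 2" by (simp add: w_def sum.distrib)
    \<comment> \<open>The additional 1 makes \<open>V\<close> positive also for \<open>n = 0\<close>.\<close>
    define V where "V = (\<Sum>i<n. w i) + 1"
    have V_pos: "0 < V" using w_pos by (simp add: V_def add_nonneg_pos sum_nonneg less_imp_le)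
    have w_ge: "expectation (\<lambda>\<omega>. (X i \<omega>)\<^sup>2) \<le> w i" for i by (simp add: w_def s_def)
    note second = sum_gaussian_squares_second_moment[where X = X and w = w and n = n, OF X w_ge w_pos]
    have "(\<Sum>i<n. w i)\<^sup>2 \<le> V\<^sup>2"
      by (rule power_mono) (simp_all add: V_def sum_nonneg less_imp_le[OF w_pos])
    then have sq_bound: "expectation (\<lambda>\<omega>. (?T n \<omega>)\<^sup>2) \<le> 3 * V\<^sup>2"
      using second(2) by simp
    \<comment> \<open>Where \<open>S \<le> K\<close> the partial sum is at most \<open>K\<close>; elsewhere \<open>(T - 6 V)\<^sup>2 \<ge> 0\<close> is used.\<close>
    have pointwise: "?T n \<omega> \<le> real K + (?T n \<omega>)\<^sup>2 / (12 * V) + 3 * V * indicator A \<omega>"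
      if "\<omega> \<in> space M" for \<omega>
    proof (cases "\<omega> \<in> A")
      case True
      have "0 \<le> (?T n \<omega> - 6 * V)\<^sup>2" by simp
      then have "12 * V * ?T n \<omega> \<le> (?T n \<omega>)\<^sup>2 + 36 * V\<^sup>2"
        by (simp only: power2_diff) (simp only: power2_eq_square; simp only: algebra_simps)
      then have "?T n \<omega> \<le> ((?T n \<omega>)\<^sup>2 + 36 * V\<^sup>2) / (12 * V)"
        using V_pos by (simp add: pos_le_divide_eq mult.commute)
      also have "\<dots> = (?T n \<omega>)\<^sup>2 / (12 * V) + 3 * V"
        using V_pos by (simp add: add_divide_distrib power2_eq_square)
      finally show ?thesis using True by simp
    next
      case False
      then have "?T n \<omega> \<le> real K" using T_le[OF that, of n] that by (simp add: A_def)
      moreover have "0 \<le> (?T n \<omega>)\<^sup>2 / (12 * V)" using V_pos by simp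
      ultimately show ?thesis using False by simp
    qed
    have ind: "integrable M (indicator A :: _ \<Rightarrow> real)"
      using A(1) by (simp add: integrable_indicator_iff emeasure_eq_measure)
    have "(\<Sum>i<n. s i) \<le> expectation (\<lambda>\<omega>. real K + (?T n \<omega>)\<^sup>2 / (12 * V) + 3 * V * indicator A \<omega>)"
      unfolding ET[symmetric] using Tint second(1) ind pointwise
      by (intro integral_mono) auto
    also have "\<dots> = real K + expectation (\<lambda>\<omega>. (?T n \<omega>)\<^sup>2) / (12 * V) + 3 * V * prob A"
      using second(1) A(1) ind by (simp add: prob_space sets.Int_space_eq2)
    also have "\<dots> \<le> real K + 3 * V\<^sup>2 / (12 * V) + 3 * V * (1 / 12)"
      using sq_bound A(2) V_pos
      by (intro add_mono mult_left_mono divide_right_mono) auto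
    also have "\<dots> = real K + V / 2"
      using V_pos by (simp add: power2_eq_square field_simps)
    finally have "(\<Sum>i<n. s i) \<le> real K + V / 2" .
    moreover have "V \<le> (\<Sum>i<n. s i) + 3" using W by (simp add: V_def)
    ultimately show ?thesis by linarith
  qed
  have "summable s"
    by (rule summableI_nonneg_bounded[OF s_nonneg bounded])
  show ?thesis
  proof (rule integrable_monotone_convergence[of M ?T S])
    show "integrable M (?T n)" for n by (rule Tint)
    show "AE \<omega> in M. mono (\<lambda>n. ?T n \<omega>)"
      by (auto intro!: AE_I2 monoI sum_mono2)
    show "AE \<omega> in M. (\<lambda>n. ?T n \<omega>) \<longlonglongrightarrow> S \<omega>"
      using S by (auto simp: sums_def)
    show "(\<lambda>n. expectation (?T n)) \<longlonglongrightarrow> suminf s"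
      unfolding ET using summable_sums[OF \<open>summable s\<close>] by (simp add: sums_def)
  qed measurable
qed

lemma (in prob_space) gaussian_L2_variable_square_integrable:
  assumes basis: "orthonormal_basis \<mu> \<phi>"
    and u: "\<And>\<omega>. \<omega> \<in> space M \<Longrightarrow> u \<omega> \<in> L2 \<mu>"
    and gauss: "\<And>i. centered_gaussian M (\<lambda>\<omega>. L2_inner \<mu> (u \<omega>) (\<phi> i))"
  shows "integrable M (\<lambda>\<omega>. L2_inner \<mu> (u \<omega>) (u \<omega>))"
  using gauss by (rule sum_gaussian_squares_integrable) (rule orthonormal_basis_Parseval[OF basis u])

section \<open>Covariance kernels are determined by rectangles\<close>

lemma (in pair_sigma_finite) integral_tensor_product:
  fixes f g :: "_ \<Rightarrow> real"
  assumes f: "integrable M1 f" and g: "integrable M2 g"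
  shows "integrable (M1 \<Otimes>\<^sub>M M2) (\<lambda>p. f (fst p) * g (snd p))"
    and "(\<integral>p. f (fst p) * g (snd p) \<partial>(M1 \<Otimes>\<^sub>M M2)) = integral\<^sup>L M1 f * integral\<^sup>L M2 g"
proof -
  have [measurable]: "f \<in> borel_measurable M1" "g \<in> borel_measurable M2" using f g by auto
  show int: "integrable (M1 \<Otimes>\<^sub>M M2) (\<lambda>p. f (fst p) * g (snd p))"
    by (rule Fubini_integrable) (use f g in \<open>auto simp: abs_mult\<close>)
  show "(\<integral>p. f (fst p) * g (snd p) \<partial>(M1 \<Otimes>\<^sub>M M2)) = integral\<^sup>L M1 f * integral\<^sup>L M2 g"
    using integral_fst'[OF int] by simp
qed

text \<open>
  The sets over which the two integrals agree form a Dynkin system, and the rectangles are a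
  generator that is closed under intersection.
\<close>

lemma AE_eq_if_rectangle_integrals_eq:
  fixes f g :: "_ \<Rightarrow> real"
  assumes f: "integrable (M \<Otimes>\<^sub>M N) f" and g: "integrable (M \<Otimes>\<^sub>M N) g"
    and rect: "\<And>A B. A \<in> sets M \<Longrightarrow> B \<in> sets N \<Longrightarrow>
      (\<integral>p\<in>A \<times> B. f p \<partial>(M \<Otimes>\<^sub>M N)) = (\<integral>p\<in>A \<times> B. g p \<partial>(M \<Otimes>\<^sub>M N))"
  shows "AE p in M \<Otimes>\<^sub>M N. f p = g p"
proof (rule density_unique_real[OF f g])
  let ?P = "M \<Otimes>\<^sub>M N" and ?G = "{A \<times> B | A B. A \<in> sets M \<and> B \<in> sets N}"
  have si: "set_integrable ?P E h" if "integrable ?P h" "E \<in> sets ?P" for E and h :: "_ \<Rightarrow> real"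
    using integrable_mult_indicator[OF that(2,1)] by (simp add: set_integrable_def)
  have whole: "(\<integral>p\<in>space ?P. f p \<partial>?P) = (\<integral>p\<in>space ?P. g p \<partial>?P)"
    unfolding space_pair_measure by (rule rect) auto
  have complement: "(\<integral>p\<in>space ?P - E. h p \<partial>?P) = (\<integral>p\<in>space ?P. h p \<partial>?P) - (\<integral>p\<in>E. h p \<partial>?P)"
    if "integrable ?P h" "E \<in> sets ?P" for E and h :: "_ \<Rightarrow> real"
  proof -
    have "(\<integral>p\<in>E \<union> (space ?P - E). h p \<partial>?P) = (\<integral>p\<in>E. h p \<partial>?P) + (\<integral>p\<in>space ?P - E. h p \<partial>?P)"
      by (rule set_integral_Un) (use that in \<open>auto intro: si\<close>)
    moreover have "E \<union> (space ?P - E) = space ?P" using sets.sets_into_space[OF that(2)] by auto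
    ultimately show ?thesis by simp
  qed
  fix E assume "E \<in> sets ?P"
  then have "E \<in> sigma_sets (space M \<times> space N) ?G" by (simp add: sets_pair_measure)
  then show "(\<integral>p\<in>E. f p \<partial>?P) = (\<integral>p\<in>E. g p \<partial>?P)"
  proof (induction rule: sigma_sets_induct_disjoint[OF Int_stable_pair_measure_generator pair_measure_closed,
        consumes 1, case_names basic empty compl union])
    case (basic E)
    then show ?case using rect by auto
  next
    case empty
    then show ?case by (simp add: set_lebesgue_integral_def)
  next
    case (compl E)
    then have "E \<in> sets ?P" by (simp add: sets_pair_measure)
    then show ?case
      using complement[OF f] complement[OF g] compl(2) whole by (simp add: space_pair_measure)
  next
    case (union E)
    then have E: "E i \<in> sets ?P" for i by (auto simp: sets_pair_measure)
    have "(\<integral>p\<in>(\<Union>i. E i). h p \<partial>?P) = (\<Sum>i. (\<integral>p\<in>E i. h p \<partial>?P))" if "integrable ?P h" for h :: "_ \<Rightarrow> real"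
      by (rule lebesgue_integral_countable_add)
        (use union(1) E in \<open>auto intro!: si that simp: disjoint_family_on_def\<close>)
    with f g union show ?case by simp
  qed
qed

text \<open>
  On a finite measure space \<open>(\<integral> \<bar>u\<bar>)\<^sup>2\<close> is at most a constant times \<open>\<parallel>u\<parallel>\<^sup>2\<close>, so a finite second moment makes
  \<open>u \<omega> s * u \<omega> s'\<close> integrable in all three variables. Everything else is Fubini.
\<close>

lemma second_moment_kernel:
  assumes "prob_space M" and "finite_measure \<mu>"
    and u: "L2_random_variable M \<mu> u"
    and sq: "integrable M (\<lambda>\<omega>. L2_inner \<mu> (u \<omega>) (u \<omega>))"
  shows "AE p in \<mu> \<Otimes>\<^sub>M \<mu>. integrable M (\<lambda>\<omega>. u \<omega> (fst p) * u \<omega> (snd p))"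
    and "integrable (\<mu> \<Otimes>\<^sub>M \<mu>) (\<lambda>p. covariance_fun M u (fst p) (snd p))"
    and "\<And>A B. A \<in> sets \<mu> \<Longrightarrow> B \<in> sets \<mu> \<Longrightarrow>
      (\<integral>p\<in>A \<times> B. covariance_fun M u (fst p) (snd p) \<partial>(\<mu> \<Otimes>\<^sub>M \<mu>)) =
      (\<integral>\<omega>. L2_inner \<mu> (u \<omega>) (indicator A) * L2_inner \<mu> (u \<omega>) (indicator B) \<partial>M)"
proof -
  interpret M: prob_space M by fact
  interpret \<mu>: finite_measure \<mu> by fact
  interpret PP: pair_sigma_finite \<mu> \<mu> ..
  interpret P: finite_measure "\<mu> \<Otimes>\<^sub>M \<mu>"
    by (rule finite_measure_pair_measure) fact+
  interpret MP: pair_sigma_finite M "\<mu> \<Otimes>\<^sub>M \<mu>" ..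
  have meas[measurable]: "(\<lambda>(\<omega>, x). u \<omega> x) \<in> borel_measurable (M \<Otimes>\<^sub>M \<mu>)"
    and uL2: "\<And>\<omega>. \<omega> \<in> space M \<Longrightarrow> u \<omega> \<in> L2 \<mu>"
    using u by (auto simp: L2_random_variable_def)
  have one: "(\<lambda>x. 1) \<in> L2 \<mu>" by (simp add: L2_def)
  have uint: "integrable \<mu> (u \<omega>)" if "\<omega> \<in> space M" for \<omega>
    using L2_integrable_mult[OF uL2[OF that] one] by simp
  let ?f = "\<lambda>(\<omega>, p). u \<omega> (fst p) * u \<omega> (snd p)"
  have f_meas[measurable]: "?f \<in> borel_measurable (M \<Otimes>\<^sub>M (\<mu> \<Otimes>\<^sub>M \<mu>))"
    by measurable
  have f: "integrable (M \<Otimes>\<^sub>M (\<mu> \<Otimes>\<^sub>M \<mu>)) ?f"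
  proof (rule MP.Fubini_integrable)
    show "AE \<omega> in M. integrable (\<mu> \<Otimes>\<^sub>M \<mu>) (\<lambda>p. ?f (\<omega>, p))"
      using PP.integral_tensor_product(1)[OF uint uint] by auto
    have inner: "(\<integral>p. norm (?f (\<omega>, p)) \<partial>(\<mu> \<Otimes>\<^sub>M \<mu>)) = (\<integral>x. \<bar>u \<omega> x\<bar> \<partial>\<mu>)\<^sup>2" if "\<omega> \<in> space M" for \<omega>
      using PP.integral_tensor_product(2)[OF integrable_abs[OF uint] integrable_abs[OF uint], OF that that]
      by (simp add: abs_mult power2_eq_square)
    have le: "(\<integral>x. \<bar>u \<omega> x\<bar> \<partial>\<mu>)\<^sup>2 \<le> L2_inner \<mu> (u \<omega>) (u \<omega>) * measure \<mu> (space \<mu>)" if "\<omega> \<in> space M" for \<omega>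
    proof -
      have a: "(\<lambda>x. \<bar>u \<omega> x\<bar>) \<in> L2 \<mu>" using uL2[OF that] by (auto simp: L2_def)
      have "\<bar>\<integral>x. \<bar>u \<omega> x\<bar> \<partial>\<mu>\<bar>\<^sup>2 \<le> (L2_norm \<mu> (\<lambda>x. \<bar>u \<omega> x\<bar>) * L2_norm \<mu> (\<lambda>x. 1))\<^sup>2"
        using L2_Cauchy_Schwarz[OF a one] by (intro power_mono) (simp_all add: L2_inner_def)
      also have "\<dots> = L2_inner \<mu> (u \<omega>) (u \<omega>) * measure \<mu> (space \<mu>)"
        by (simp add: power_mult_distrib L2_norm_power2) (simp add: L2_inner_def)
      finally show ?thesis by simp
    qed
    show "integrable M (\<lambda>\<omega>. \<integral>p. norm (?f (\<omega>, p)) \<partial>(\<mu> \<Otimes>\<^sub>M \<mu>))"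
    proof (rule Bochner_Integration.integrable_bound)
      show "integrable M (\<lambda>\<omega>. L2_inner \<mu> (u \<omega>) (u \<omega>) * measure \<mu> (space \<mu>))"
        using sq by simp
      show "(\<lambda>\<omega>. \<integral>p. norm (?f (\<omega>, p)) \<partial>(\<mu> \<Otimes>\<^sub>M \<mu>)) \<in> borel_measurable M"
        by measurable
      show "AE \<omega> in M. norm (\<integral>p. norm (?f (\<omega>, p)) \<partial>(\<mu> \<Otimes>\<^sub>M \<mu>))
          \<le> norm (L2_inner \<mu> (u \<omega>) (u \<omega>) * measure \<mu> (space \<mu>))"
      proof (rule AE_I2)
        fix \<omega> assume "\<omega> \<in> space M"
        with inner le show "norm (\<integral>p. norm (?f (\<omega>, p)) \<partial>(\<mu> \<Otimes>\<^sub>M \<mu>))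
          \<le> norm (L2_inner \<mu> (u \<omega>) (u \<omega>) * measure \<mu> (space \<mu>))"
          by (simp add: L2_inner_self_nonneg)
      qed
    qed
  qed measurable
  show "AE p in \<mu> \<Otimes>\<^sub>M \<mu>. integrable M (\<lambda>\<omega>. u \<omega> (fst p) * u \<omega> (snd p))"
    using MP.AE_integrable_snd[OF f] by simp
  show "integrable (\<mu> \<Otimes>\<^sub>M \<mu>) (\<lambda>p. covariance_fun M u (fst p) (snd p))"
    unfolding covariance_fun_def by (rule MP.integrable_snd[OF f])
  fix A B assume A: "A \<in> sets \<mu>" and B: "B \<in> sets \<mu>"
  let ?g = "\<lambda>\<omega> p. indicator (A \<times> B) p * (u \<omega> (fst p) * u \<omega> (snd p))"
  have "integrable (M \<Otimes>\<^sub>M (\<mu> \<Otimes>\<^sub>M \<mu>)) (\<lambda>q. indicator (space M \<times> (A \<times> B)) q *\<^sub>R ?f q)"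
    using f by (rule integrable_mult_indicator[rotated]) (use A B in auto)
  then have g: "integrable (M \<Otimes>\<^sub>M (\<mu> \<Otimes>\<^sub>M \<mu>)) (case_prod ?g)"
    by (rule Bochner_Integration.integrable_cong[THEN iffD1, OF refl, rotated])
      (auto simp: space_pair_measure indicator_def)
  have "(\<integral>p\<in>A \<times> B. covariance_fun M u (fst p) (snd p) \<partial>(\<mu> \<Otimes>\<^sub>M \<mu>))
      = (\<integral>p. (\<integral>\<omega>. ?g \<omega> p \<partial>M) \<partial>(\<mu> \<Otimes>\<^sub>M \<mu>))"
    by (simp add: set_lebesgue_integral_def covariance_fun_def)
  also have "\<dots> = (\<integral>\<omega>. (\<integral>p. ?g \<omega> p \<partial>(\<mu> \<Otimes>\<^sub>M \<mu>)) \<partial>M)"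
    by (rule MP.Fubini_integral[OF g])
  also have "\<dots> = (\<integral>\<omega>. L2_inner \<mu> (u \<omega>) (indicator A) * L2_inner \<mu> (u \<omega>) (indicator B) \<partial>M)"
  proof (rule Bochner_Integration.integral_cong[OF refl])
    fix \<omega> assume \<omega>: "\<omega> \<in> space M"
    have ind: "integrable \<mu> (\<lambda>x. u \<omega> x * indicator C x)" if "C \<in> sets \<mu>" for C
      using integrable_real_mult_indicator[OF that uint[OF \<omega>]] by simp
    have "?g \<omega> p = (u \<omega> (fst p) * indicator A (fst p)) * (u \<omega> (snd p) * indicator B (snd p))" for p
      by (cases p) (simp add: indicator_times)
    then show "(\<integral>p. ?g \<omega> p \<partial>(\<mu> \<Otimes>\<^sub>M \<mu>)) = L2_inner \<mu> (u \<omega>) (indicator A) * L2_inner \<mu> (u \<omega>) (indicator B)"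
      using PP.integral_tensor_product(2)[OF ind[OF A] ind[OF B]] unfolding L2_inner_def by (simp only:)
  qed
  finally show "(\<integral>p\<in>A \<times> B. covariance_fun M u (fst p) (snd p) \<partial>(\<mu> \<Otimes>\<^sub>M \<mu>)) =
      (\<integral>\<omega>. L2_inner \<mu> (u \<omega>) (indicator A) * L2_inner \<mu> (u \<omega>) (indicator B) \<partial>M)" .
qed

section \<open>Weak eigenfunctions on an interval are classical\<close>

lemma set_integrable_L2_interval:
  fixes q :: "real \<Rightarrow> real"
  assumes "q \<in> L2 (restrict_space lborel {0..l})"
  shows "set_integrable lborel {0..l} q"
proof -
  interpret finite_measure "restrict_space lborel {0..l}"
    by (rule finite_measureI) (subst emeasure_restrict_space; simp add: space_restrict_space emeasure_lborel_Icc_eq)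
  have "integrable (restrict_space lborel {0..l}) q"
  proof (rule Bochner_Integration.integrable_bound)
    show "integrable (restrict_space lborel {0..l}) (\<lambda>t. 1 + (q t)\<^sup>2)"
      using assms by (auto simp: L2_def)
    show "q \<in> borel_measurable (restrict_space lborel {0..l})"
      using assms by (simp add: L2_def)
    have "\<bar>x\<bar> \<le> 1 + x\<^sup>2" for x :: real
      using sum_squares_bound[of 1 "\<bar>x\<bar>"] abs_ge_zero[of x] by (simp only: power2_abs power_one)
    then show "AE t in restrict_space lborel {0..l}. norm (q t) \<le> norm (1 + (q t)\<^sup>2)"
      by simp
  qed
  then show ?thesis
    unfolding set_integrable_def by (subst (asm) integrable_restrict_space) auto
qed

lemma set_integrable_mult_continuous:
  fixes q \<psi> :: "real \<Rightarrow> real"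
  assumes q: "set_integrable lborel {0..l} q" and \<psi>: "continuous_on UNIV \<psi>"
  shows "set_integrable lborel {0..l} (\<lambda>t. q t * \<psi> t)"
proof -
  have "compact (\<psi> ` {0..l})"
    using \<psi> by (intro compact_continuous_image continuous_on_subset[OF \<psi>]) auto
  then obtain B where "\<forall>x\<in>\<psi> ` {0..l}. norm x \<le> B"
    using compact_imp_bounded bounded_iff by blast
  then have B: "\<bar>\<psi> t\<bar> \<le> B" if "t \<in> {0..l}" for t
    using that by auto
  have [measurable]: "\<psi> \<in> borel_measurable borel"
    using \<psi> by (rule borel_measurable_continuous_onI)
  have [measurable]: "(\<lambda>t. indicator {0..l} t * q t) \<in> borel_measurable lborel"
    using q by (auto simp: set_integrable_def)
  have "integrable lborel (\<lambda>t. (indicator {0..l} t * q t) * \<psi> t)"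
  proof (rule Bochner_Integration.integrable_bound)
    show "integrable lborel (\<lambda>t. B * (indicator {0..l} t * q t))"
      using q by (auto simp: set_integrable_def)
    have "\<bar>x * \<psi> t\<bar> \<le> \<bar>B * x\<bar>" if "t \<in> {0..l}" for x t
      using mult_left_mono[OF B[OF that] abs_ge_zero[of x]] B[OF that]
      by (simp add: abs_mult mult.commute)
    then show "AE t in lborel. norm (indicator {0..l} t * q t * \<psi> t) \<le> norm (B * (indicator {0..l} t * q t))"
      by (auto simp: indicator_def)
  qed measurable
  then show ?thesis by (simp add: set_integrable_def mult.assoc)
qed

text \<open>
  Almost every point is a Lebesgue point, where the function is the limit of its interval averages.
\<close>

lemma AE_zero_if_interval_integrals_zero:
  fixes q :: "real \<Rightarrow> real"
  assumes q: "set_integrable lborel {0..l} q"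
    and zero: "\<And>a b. 0 < a \<Longrightarrow> a < b \<Longrightarrow> b < l \<Longrightarrow> (LBINT t:{a..b}. q t) = 0"
  shows "AE t in lborel. t \<in> {0<..<l} \<longrightarrow> q t = 0"
proof -
  define f where "f t = indicator {0..l} t * q t" for t
  have f: "integrable lborel f"
    using q by (simp add: f_def[abs_def] set_integrable_def)
  then have "f integrable_on cbox a b" for a b
    using integrable_on_lborel integrable_on_subcbox by (meson subset_UNIV)
  then obtain N where N: "negligible N"
    and lim: "\<And>x e. x \<notin> N \<Longrightarrow> 0 < e \<Longrightarrow> \<exists>d>0. \<forall>h. 0 < h \<and> h < d \<longrightarrow>
        norm (integral (cbox x (x + h *\<^sub>R One)) f /\<^sub>R h ^ DIM(real) - f x) < e"
    using integrable_ccontinuous_explicit[of f] by auto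
  have *: "q x = 0" if "x \<notin> N" "0 < x" "x < l" for x
  proof -
    have "\<bar>f x\<bar> \<le> e" if "0 < e" for e
    proof -
      obtain d where "0 < d" and d: "\<And>h. 0 < h \<Longrightarrow> h < d \<Longrightarrow>
          norm (integral (cbox x (x + h *\<^sub>R One)) f /\<^sub>R h ^ DIM(real) - f x) < e"
        using lim[OF \<open>x \<notin> N\<close> \<open>0 < e\<close>] by auto
      define h where "h = min d (l - x) / 2"
      have h: "0 < h" "h < d" "x + h < l" using \<open>0 < d\<close> \<open>x < l\<close> by (auto simp: h_def min_def field_simps)
      have si: "set_integrable lborel {x..x+h} q"
        using q by (rule set_integrable_subset) (use h \<open>0 < x\<close> in auto)
      have "integral {x..x+h} f = integral {x..x+h} q"
        by (rule Henstock_Kurzweil_Integration.integral_cong) (use h \<open>0 < x\<close> in \<open>auto simp: f_def\<close>)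
      also have "\<dots> = (LBINT t:{x..x+h}. q t)"
        using set_borel_integral_eq_integral[OF si] by simp
      also have "\<dots> = 0" using h \<open>0 < x\<close> by (intro zero) auto
      finally show ?thesis using d[OF h(1,2)] by simp
    qed
    then have "f x = 0" by (metis abs_le_zero_iff dense_ge)
    then show ?thesis using that by (simp add: f_def)
  qed
  have "AE x in lborel. x \<notin> N"
  proof -
    obtain N' where N': "N' \<in> null_sets lborel" "N \<subseteq> N'"
      using N unfolding negligible_iff_null_sets null_sets_completion_iff2 by blast
    from AE_not_in[OF N'(1)] show ?thesis
      by (rule eventually_mono) (use N'(2) in blast)
  qed
  then show ?thesis
    by (rule eventually_mono) (simp add: *)
qed

text \<open>
  The mean value condition makes the primitive vanish on both sides of the support. This is how test
  functions with prescribed derivative are produced below.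
\<close>

lemma mean_zero_has_test_primitive:
  fixes \<psi> :: "real \<Rightarrow> real"
  assumes \<psi>: "continuous_on UNIV \<psi>" and supp: "\<And>t. t \<notin> {a<..<b} \<Longrightarrow> \<psi> t = 0" and "a \<le> b"
    and mean: "integral {a..b} \<psi> = 0"
  obtains \<phi> where "\<phi> C1_differentiable_on UNIV" "\<And>t. t \<notin> {a..b} \<Longrightarrow> \<phi> t = 0" "deriv \<phi> = \<psi>"
proof -
  obtain F where F: "\<And>t. (F has_vector_derivative \<psi> t) (at t)"
    using einterval_antiderivative[of "-\<infinity>" "\<infinity>" \<psi>] \<psi> by (auto simp: continuous_on_eq_continuous_at)
  have ftc: "(\<psi> has_integral (F t - F s)) {s..t}" if "s \<le> t" for s t
    using that F by (intro fundamental_theorem_of_calculus) (auto intro: has_vector_derivative_at_within)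
  have const: "F t = F s" if "s \<le> t" "t \<le> a \<or> b \<le> s" for s t
  proof -
    have "(\<psi> has_integral 0) {s..t}"
      by (rule has_integral_is_0) (use that supp in force)
    with ftc[OF that(1)] show ?thesis by (auto dest: has_integral_unique)
  qed
  have "F b = F a"
    using ftc[OF \<open>a \<le> b\<close>] mean by (auto dest: integral_unique)
  define \<phi> where "\<phi> t = F t - F a" for t
  have d: "(\<phi> has_vector_derivative \<psi> t) (at t)" for t
    unfolding \<phi>_def[abs_def] using has_vector_derivative_diff[OF F has_vector_derivative_const] by simp
  show ?thesis
  proof
    show "\<phi> C1_differentiable_on UNIV"
      using d \<psi> by (auto simp: C1_differentiable_on_def)
    show "\<phi> t = 0" if "t \<notin> {a..b}" for t
      using that const[of t a] const[of b t] \<open>F b = F a\<close> by (auto simp: \<phi>_def)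
    show "deriv \<phi> = \<psi>"
      using d by (auto simp: has_real_derivative_iff_has_vector_derivative[symmetric] intro: DERIV_imp_deriv)
  qed
qed

text \<open>
  A continuous function supported in \<open>[a, b]\<close> that increases to the indicator of the open interval as
  the slope \<open>n\<close> grows.
\<close>

definition trapezoid :: "real \<Rightarrow> real \<Rightarrow> nat \<Rightarrow> real \<Rightarrow> real" where
  "trapezoid a b n t = max 0 (min 1 (real n * min (t - a) (b - t)))"

lemma continuous_on_trapezoid: "continuous_on S (trapezoid a b n)"
  unfolding trapezoid_def[abs_def] by (intro continuous_intros)

lemma trapezoid_outside: "t \<notin> {a<..<b} \<Longrightarrow> trapezoid a b n t = 0"
proof -
  assume "t \<notin> {a<..<b}"
  then have "real n * min (t - a) (b - t) \<le> 0"
    by (intro mult_nonneg_nonpos) auto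
  then show ?thesis by (simp add: trapezoid_def)
qed

lemma trapezoid_tendsto_indicator:
  assumes "t \<noteq> a" "t \<noteq> b"
  shows "(\<lambda>n. trapezoid a b n t) \<longlonglongrightarrow> indicator {a..b} t"
proof (cases "t \<in> {a<..<b}")
  case True
  define m where "m = min (t - a) (b - t)"
  have "0 < m" using True by (simp add: m_def)
  obtain N where N: "1 / m < real N" using reals_Archimedean2 by blast
  have "trapezoid a b n t = 1" if "N \<le> n" for n
  proof -
    have "1 / m < real n" using N that by simp
    then have "1 \<le> real n * m" using \<open>0 < m\<close> by (simp add: field_simps)
    then show ?thesis by (simp add: trapezoid_def m_def)
  qed
  then have "\<forall>\<^sub>F n in sequentially. trapezoid a b n t = indicator {a..b} t"
    using True by (auto simp: eventually_sequentially)
  then show ?thesis by (rule tendsto_eventually)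
next
  case False
  then show ?thesis using assms by (auto simp: trapezoid_outside)
qed

lemma trapezoid_integral_tendsto:
  assumes q: "set_integrable lborel {0..l} q" and "0 \<le> a" "b \<le> l"
  shows "(\<lambda>n. LBINT t:{0..l}. q t * trapezoid a b n t) \<longlonglongrightarrow> (LBINT t:{a..b}. q t)"
  unfolding set_lebesgue_integral_def
proof (rule integral_dominated_convergence[where w="\<lambda>t. \<bar>indicator {0..l} t * q t\<bar>"])
  show "integrable lborel (\<lambda>t. \<bar>indicator {0..l} t * q t\<bar>)"
    using q by (auto simp: set_integrable_def)
  show "(\<lambda>t. indicator {0..l} t *\<^sub>R (q t * trapezoid a b n t)) \<in> borel_measurable lborel" for n
    using set_integrable_mult_continuous[OF q continuous_on_trapezoid]
    by (auto simp: set_integrable_def)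
  have "set_integrable lborel {a..b} q"
    using q by (rule set_integrable_subset) (use assms in auto)
  then show "(\<lambda>t. indicator {a..b} t *\<^sub>R q t) \<in> borel_measurable lborel"
    by (auto simp: set_integrable_def)
  have "AE t in lborel. t \<noteq> a" "AE t in lborel. t \<noteq> b"
    by (auto intro: AE_lborel_singleton)
  then show "AE t in lborel. (\<lambda>n. indicator {0..l} t *\<^sub>R (q t * trapezoid a b n t)) \<longlonglongrightarrow> indicator {a..b} t *\<^sub>R q t"
  proof eventually_elim
    case (elim t)
    have "(\<lambda>n. (indicator {0..l} t * q t) * trapezoid a b n t) \<longlonglongrightarrow> (indicator {0..l} t * q t) * indicator {a..b} t"
      by (intro tendsto_mult_left trapezoid_tendsto_indicator elim)
    moreover have "(indicator {0..l} t * q t) * indicator {a..b} t = indicator {a..b} t *\<^sub>R q t"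
      using assms by (auto simp: indicator_def)
    ultimately show ?case
      unfolding real_scaleR_def mult.assoc[symmetric] by (simp only:)
  qed
  have "\<bar>x * trapezoid a b n t\<bar> \<le> \<bar>x\<bar>" for x n t
    using mult_left_mono[of "\<bar>trapezoid a b n t\<bar>" 1 "\<bar>x\<bar>"] by (simp add: abs_mult trapezoid_def)
  from this[of "indicator {0..l} _ * q _"]
  show "AE t in lborel. norm (indicator {0..l} t *\<^sub>R (q t * trapezoid a b n t)) \<le> \<bar>indicator {0..l} t * q t\<bar>" for n
    by (simp add: mult.assoc)
qed

text \<open>
  A continuous function \<open>\<psi>\<close> of mean zero with support inside the interval is the derivative of a test
  function, so \<open>q\<close> integrates to zero against it. Taking for \<open>\<psi>\<close> the combination of two trapezoids
  that has mean zero and letting the slopes tend to infinity shows that \<open>\<integral> q\<close> over a subinterval is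
  proportional to its length, so \<open>q\<close> is constant almost everywhere.
\<close>

lemma du_Bois_Reymond:
  fixes q :: "real \<Rightarrow> real"
  assumes q: "set_integrable lborel {0..l} q"
    and test: "\<And>\<phi> K. \<phi> C1_differentiable_on UNIV \<Longrightarrow> compact K \<Longrightarrow> K \<subseteq> {0<..<l} \<Longrightarrow>
       (\<And>t. t \<notin> K \<Longrightarrow> \<phi> t = 0) \<Longrightarrow> (LBINT t:{0..l}. q t * deriv \<phi> t) = 0"
  shows "\<exists>c. AE t in lborel. t \<in> {0<..<l} \<longrightarrow> q t = c"
proof (cases "0 < l")
  case False
  then show ?thesis by auto
next
  case True
  have one: "set_integrable lborel {0..l} (\<lambda>t. 1::real)"
    by (intro borel_integrable_atLeastAtMost') auto
  let ?I = "\<lambda>a b n. LBINT t:{0..l}. q t * trapezoid a b n t"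
  let ?J = "\<lambda>a b n. LBINT t:{0..l}. 1 * trapezoid a b n t"
  have I: "?I a b \<longlonglongrightarrow> (LBINT t:{a..b}. q t)" if "0 < a" "a < b" "b < l" for a b
    using trapezoid_integral_tendsto[OF q, of a b] that by simp
  have J: "?J a b \<longlonglongrightarrow> b - a" if "0 < a" "a < b" "b < l" for a b
    using trapezoid_integral_tendsto[OF one, of a b] that by (simp add: set_lebesgue_integral_def)
  have prop_n: "?J c d n * ?I a b n = ?J a b n * ?I c d n"
    if ab: "0 < a" "a < b" "b < l" and cd: "0 < c" "c < d" "d < l" for a b c d n
  proof -
    \<comment> \<open>The coefficients are chosen such that \<open>\<psi>\<close> has mean zero.\<close>
    define \<psi> where "\<psi> t = ?J c d n * trapezoid a b n t - ?J a b n * trapezoid c d n t" for t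
    have \<psi>: "continuous_on UNIV \<psi>"
      unfolding \<psi>_def[abs_def] by (intro continuous_intros continuous_on_trapezoid)
    let ?s = "min a c" and ?t = "max b d"
    have supp: "\<psi> t = 0" if "t \<notin> {?s<..<?t}" for t
    proof -
      have "t \<notin> {a<..<b}" "t \<notin> {c<..<d}" using that by auto
      then show ?thesis by (simp add: \<psi>_def trapezoid_outside)
    qed
    have le: "?s \<le> ?t" using that by auto
    have sub: "{?s..?t} \<subseteq> {0<..<l}" using that by auto
    have intJ: "set_integrable lborel {0..l} (\<lambda>t. trapezoid a b n t)" for a b
      by (intro borel_integrable_atLeastAtMost' continuous_on_trapezoid)
    have "integral {?s..?t} \<psi> = integral {0..l} \<psi>"
    proof (rule integral_unique[symmetric], rule has_integral_on_superset)
      show "(\<psi> has_integral integral {?s..?t} \<psi>) {?s..?t}"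
        by (intro integrable_integral integrable_continuous_real continuous_on_subset[OF \<psi>]) auto
      show "{?s..?t} \<subseteq> {0..l}" using that by auto
      show "\<psi> x = 0" if "x \<notin> {?s..?t}" for x using that by (intro supp) auto
    qed
    also have "\<dots> = (LBINT t:{0..l}. \<psi> t)"
      using set_borel_integral_eq_integral[OF borel_integrable_atLeastAtMost'[OF continuous_on_subset[OF \<psi>]]]
      by simp
    also have "\<dots> = 0"
      using intJ by (simp add: \<psi>_def)
    finally have mean: "integral {?s..?t} \<psi> = 0" .
    obtain \<phi> where \<phi>: "\<phi> C1_differentiable_on UNIV" "\<And>t. t \<notin> {?s..?t} \<Longrightarrow> \<phi> t = 0" "deriv \<phi> = \<psi>"
      using mean_zero_has_test_primitive[OF \<psi> supp le mean] by blast
    have "0 = (LBINT t:{0..l}. q t * \<psi> t)"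
      using test[OF \<phi>(1) compact_Icc sub \<phi>(2)] \<phi>(3) by simp
    also have "\<dots> = (LBINT t:{0..l}. ?J c d n * (q t * trapezoid a b n t) - ?J a b n * (q t * trapezoid c d n t))"
      by (simp add: \<psi>_def algebra_simps)
    also have "\<dots> = ?J c d n * ?I a b n - ?J a b n * ?I c d n"
      using set_integrable_mult_continuous[OF q continuous_on_trapezoid] by simp
    finally show ?thesis by simp
  qed
  have ratio: "(d - c) * (LBINT t:{a..b}. q t) = (b - a) * (LBINT t:{c..d}. q t)"
    if ab: "0 < a" "a < b" "b < l" and cd: "0 < c" "c < d" "d < l" for a b c d
    using tendsto_mult[OF J[OF cd] I[OF ab]] tendsto_mult[OF J[OF ab] I[OF cd]]
    unfolding prop_n[OF ab cd] by (rule LIMSEQ_unique)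
  \<comment> \<open>The mean of \<open>q\<close> over one fixed subinterval of length \<open>l/3\<close>.\<close>
  define C where "C = (LBINT t:{l/3..2*l/3}. q t) / (l/3)"
  have "AE t in lborel. t \<in> {0<..<l} \<longrightarrow> q t - C = 0"
  proof (rule AE_zero_if_interval_integrals_zero)
    have c: "set_integrable lborel {a..b} (\<lambda>t. C)" for a b :: real
      by (intro borel_integrable_atLeastAtMost') auto
    show "set_integrable lborel {0..l} (\<lambda>t. q t - C)"
      using q c by (rule set_integral_diff(1))
    show "(LBINT t:{a..b}. q t - C) = 0" if ab: "0 < a" "a < b" "b < l" for a b
    proof -
      have "set_integrable lborel {a..b} q"
        using q by (rule set_integrable_subset) (use ab in auto)
      then have "(LBINT t:{a..b}. q t - C) = (LBINT t:{a..b}. q t) - (b - a) * C"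
        using c ab by (simp add: set_integral_diff) (simp add: set_lebesgue_integral_def)
      also have "\<dots> = 0"
        using ratio[OF ab, of "l/3" "2*l/3"] True by (simp add: C_def field_simps)
      finally show ?thesis .
    qed
  qed
  then show ?thesis by auto
qed

text \<open>
  Classical integration by parts shows that \<open>H\<close> has the same weak derivative as \<open>q\<close>; then the du
  Bois-Reymond lemma applies to \<open>q - H\<close>.
\<close>

lemma weak_derivative_continuous_primitive:
  assumes weak: "weak_derivative l q r" and "0 < l" and R: "continuous_on {0..l} R"
    and r: "AE t in lborel. t \<in> {0..l} \<longrightarrow> r t = R t"
    and H: "\<And>t. t \<in> {0..l} \<Longrightarrow> (H has_real_derivative R t) (at t within {0..l})"
  shows "\<exists>c. AE t in lborel. t \<in> {0<..<l} \<longrightarrow> q t = H t + c"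
proof -
  have q: "set_integrable lborel {0..l} q"
    using weak by (simp add: weak_derivative_def set_integrable_L2_interval)
  have ri: "set_integrable lborel {0..l} r"
    using weak by (simp add: weak_derivative_def set_integrable_L2_interval)
  have contH: "continuous_on {0..l} H"
    using H by (rule DERIV_continuous_on)
  then have Hi: "set_integrable lborel {0..l} H"
    by (rule borel_integrable_atLeastAtMost')
  have "\<exists>c. AE t in lborel. t \<in> {0<..<l} \<longrightarrow> q t - H t = c"
  proof (rule du_Bois_Reymond)
    show "set_integrable lborel {0..l} (\<lambda>t. q t - H t)"
      using q Hi by (rule set_integral_diff(1))
    fix \<phi> :: "real \<Rightarrow> real" and K assume \<phi>: "\<phi> C1_differentiable_on UNIV" and K: "compact K" "K \<subseteq> {0<..<l}" "\<And>t. t \<notin> K \<Longrightarrow> \<phi> t = 0"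
    from \<phi> obtain D where D: "\<And>t. (\<phi> has_vector_derivative D t) (at t)" and cD: "continuous_on UNIV D"
      by (auto simp: C1_differentiable_on_def)
    have dD: "deriv \<phi> = D"
      using D by (auto simp: has_real_derivative_iff_has_vector_derivative[symmetric] intro: DERIV_imp_deriv)
    have c\<phi>: "continuous_on UNIV \<phi>"
      using D by (meson continuous_at_imp_continuous_on has_vector_derivative_continuous)
    have "(LBINT t:{0..l}. H t * D t + R t * \<phi> t) = H l * \<phi> l - H 0 * \<phi> 0"
      unfolding set_lebesgue_integral_def
    proof (rule integral_FTC_Icc)
      show "((\<lambda>t. H t * \<phi> t) has_vector_derivative H t * D t + R t * \<phi> t) (at t within {0..l})"
        if "0 \<le> t" "t \<le> l" for t
        using has_vector_derivative_mult[of H "R t" t "{0..l}" \<phi> "D t"] H[of t] D[of t] that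
        by (auto simp: has_real_derivative_iff_has_vector_derivative intro: has_vector_derivative_at_within)
      show "continuous_on {0..l} (\<lambda>t. H t * D t + R t * \<phi> t)"
        using contH R continuous_on_subset[OF cD] continuous_on_subset[OF c\<phi>]
        by (intro continuous_intros) auto
    qed (use \<open>0 < l\<close> in auto)
    moreover have "\<phi> s = 0" if "s \<notin> {0<..<l}" for s using K(2) that by (intro K(3)) auto
    ultimately have "(LBINT t:{0..l}. H t * D t + R t * \<phi> t) = 0" by simp
    moreover have Ri: "set_integrable lborel {0..l} (\<lambda>t. R t * \<phi> t)"
      using R c\<phi> by (intro set_integrable_mult_continuous borel_integrable_atLeastAtMost')
    moreover note HDi = set_integrable_mult_continuous[OF Hi cD]
    ultimately have HD: "(LBINT t:{0..l}. H t * D t) = - (LBINT t:{0..l}. R t * \<phi> t)"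
      by (simp add: set_integral_add)
    have qD: "(LBINT t:{0..l}. q t * D t) = - (LBINT t:{0..l}. r t * \<phi> t)"
      using weak[unfolded weak_derivative_def, THEN conjunct2, THEN conjunct2, rule_format, of \<phi> K] \<phi> K
      by (simp add: dD)
    have "(LBINT t:{0..l}. r t * \<phi> t) = (LBINT t:{0..l}. R t * \<phi> t)"
      unfolding set_lebesgue_integral_def
    proof (rule integral_cong_AE)
      show "(\<lambda>t. indicator {0..l} t *\<^sub>R (r t * \<phi> t)) \<in> borel_measurable lborel"
        using set_integrable_mult_continuous[OF ri c\<phi>] unfolding set_integrable_def
        by (rule borel_measurable_integrable)
      show "(\<lambda>t. indicator {0..l} t *\<^sub>R (R t * \<phi> t)) \<in> borel_measurable lborel"
        using Ri unfolding set_integrable_def by (rule borel_measurable_integrable)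
      show "AE t in lborel. indicator {0..l} t *\<^sub>R (r t * \<phi> t) = indicator {0..l} t *\<^sub>R (R t * \<phi> t)"
        using r by (rule eventually_mono) (simp add: indicator_def)
    qed
    then have "(LBINT t:{0..l}. q t * D t) - (LBINT t:{0..l}. H t * D t) = 0"
      using HD qD by simp
    then show "(LBINT t:{0..l}. (q t - H t) * deriv \<phi> t) = 0"
      using set_integral_diff(2)[OF set_integrable_mult_continuous[OF q cD] HDi]
      by (simp add: dD left_diff_distrib)
  qed
  then show ?thesis by (auto simp: algebra_simps)
qed

lemma continuous_AE_zero:
  fixes u :: "real \<Rightarrow> real"
  assumes "0 < l" and u: "continuous_on {0..l} u" and ae: "AE t in lborel. t \<in> {0<..<l} \<longrightarrow> u t = 0"
    and t: "t \<in> {0..l}"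
  shows "u t = 0"
proof -
  have zero: "integral {0..s} u = 0" if "s \<in> {0..l}" for s
  proof -
    have si: "set_integrable lborel {0..s} u"
      using that by (intro borel_integrable_atLeastAtMost' continuous_on_subset[OF u]) auto
    have "AE t in lborel. t \<noteq> 0" "AE t in lborel. t \<noteq> l"
      by (auto intro: AE_lborel_singleton)
    then have "AE t in lborel. indicator {0..s} t *\<^sub>R u t = 0"
      using ae by eventually_elim (use that in \<open>auto simp: indicator_def\<close>)
    then have "(LBINT t:{0..s}. u t) = 0"
      unfolding set_lebesgue_integral_def by (rule integral_eq_zero_AE)
    then show ?thesis using set_borel_integral_eq_integral[OF si] by simp
  qed
  have "((\<lambda>s. integral {0..s} u) has_vector_derivative u t) (at t within {0..l})"
    using u t by (rule integral_has_vector_derivative)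
  then have "((\<lambda>s. 0) has_vector_derivative u t) (at t within {0..l})"
    by (rule has_vector_derivative_transform[rotated 2]) (use t zero in auto)
  then show ?thesis
    using vector_derivative_unique_within_closed_interval[of 0 l t "\<lambda>s. 0" "u t" 0] \<open>0 < l\<close> t
      has_vector_derivative_const[of 0 "at t within {0..l}"]
    unfolding box_real by blast
qed

text \<open>
  Bootstrapping: \<open>h\<close> is represented by the continuous function \<open>c f\<close>, hence the weak derivative of \<open>f\<close>
  is represented by a continuously differentiable function, hence so is \<open>f\<close>. The last representation
  holds everywhere and not only almost everywhere since \<open>f\<close> is continuous.
\<close>

lemma weak_eigenfunction_is_classical:
  assumes "0 < l" and weak: "second_weak_derivative l f h" and f: "continuous_on {0..l} f"
    and h: "AE t in lborel. t \<in> {0..l} \<longrightarrow> h t = c * f t"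
  shows "\<exists>p. \<forall>t\<in>{0..l}. (f has_real_derivative p t) (at t within {0..l}) \<and>
    (p has_real_derivative c * f t) (at t within {0..l})"
proof -
  obtain g where fg: "weak_derivative l f g" and gh: "weak_derivative l g h"
    using weak by (auto simp: second_weak_derivative_def)
  have cf: "continuous_on {0..l} (\<lambda>t. c * f t)" by (intro continuous_intros f)
  have "\<exists>d. AE t in lborel. t \<in> {0<..<l} \<longrightarrow> g t = integral {0..t} (\<lambda>t. c * f t) + d"
    using integral_has_real_derivative[OF cf]
    by (intro weak_derivative_continuous_primitive[OF gh \<open>0 < l\<close> cf h]) blast
  then obtain d where d: "AE t in lborel. t \<in> {0<..<l} \<longrightarrow> g t = integral {0..t} (\<lambda>t. c * f t) + d" by blast
  define p where "p t = integral {0..t} (\<lambda>t. c * f t) + d" for t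
  have p: "(p has_real_derivative c * f t) (at t within {0..l})" if "t \<in> {0..l}" for t
    unfolding p_def[abs_def]
    using DERIV_add[OF integral_has_real_derivative[OF cf that] DERIV_const[of d]] by (simp only: add_0_right)
  then have cp: "continuous_on {0..l} p" by (rule DERIV_continuous_on)
  have "AE t in lborel. t \<noteq> 0" "AE t in lborel. t \<noteq> l"
    by (auto intro: AE_lborel_singleton)
  with d have gp: "AE t in lborel. t \<in> {0..l} \<longrightarrow> g t = p t"
    by eventually_elim (auto simp: p_def)
  have "\<exists>d. AE t in lborel. t \<in> {0<..<l} \<longrightarrow> f t = integral {0..t} p + d"
    using integral_has_real_derivative[OF cp]
    by (intro weak_derivative_continuous_primitive[OF fg \<open>0 < l\<close> cp gp]) blast
  then obtain e where e: "AE t in lborel. t \<in> {0<..<l} \<longrightarrow> f t = integral {0..t} p + e" by blast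
  have prim: "((\<lambda>t. integral {0..t} p + e) has_real_derivative p t) (at t within {0..l})" if "t \<in> {0..l}" for t
    using DERIV_add[OF integral_has_real_derivative[OF cp that] DERIV_const[of e]] by (simp only: add_0_right)
  have "f t - (integral {0..t} p + e) = 0" if "t \<in> {0..l}" for t
  proof (rule continuous_AE_zero[OF \<open>0 < l\<close> _ _ that])
    show "continuous_on {0..l} (\<lambda>t. f t - (integral {0..t} p + e))"
      by (intro continuous_on_diff f DERIV_continuous_on[OF prim])
    show "AE t in lborel. t \<in> {0<..<l} \<longrightarrow> f t - (integral {0..t} p + e) = 0"
      using e by simp
  qed
  then have eq: "integral {0..t} p + e = f t" if "t \<in> {0..l}" for t using that by simp
  have "(f has_real_derivative p t) (at t within {0..l})" if "t \<in> {0..l}" for t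
    using prim[OF that] zero_less_one that eq by (rule has_field_derivative_transform_within)
  with p show ?thesis by blast
qed

section \<open>Integration over a metric graph\<close>

lemma graph_points_measurable:
  assumes "finite (arcs G)"
  shows "graph_points G len \<in> sets (count_space (arcs G) \<Otimes>\<^sub>M lborel)"
proof -
  have "graph_points G len = (\<Union>e\<in>arcs G. {e} \<times> {0..len e})"
    by (auto simp: graph_points_def)
  also have "\<dots> \<in> sets (count_space (arcs G) \<Otimes>\<^sub>M lborel)"
    using assms by (intro sets.finite_UN pair_measureI) auto
  finally show ?thesis .
qed

lemma space_graph_measure: "space (graph_measure G len) = graph_points G len"
  by (auto simp: graph_measure_def space_restrict_space space_pair_measure graph_points_def)

lemma pair_sigma_finite_graph: "finite (arcs G) \<Longrightarrow> pair_sigma_finite (count_space (arcs G)) lborel"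
  by (intro pair_sigma_finite.intro sigma_finite_measure_count_space_finite lborel.sigma_finite_measure_axioms)

lemma nn_integral_graph_measure:
  assumes fin: "finite (arcs G)" and f: "f \<in> borel_measurable (graph_measure G len)"
  shows "(\<integral>\<^sup>+x. f x \<partial>graph_measure G len) = (\<Sum>e\<in>arcs G. \<integral>\<^sup>+t. f (e, t) * indicator {0..len e} t \<partial>lborel)"
proof -
  let ?N = "count_space (arcs G) \<Otimes>\<^sub>M lborel" and ?P = "graph_points G len"
  note P = graph_points_measurable[OF fin, of len]
  have m: "(\<lambda>x. f x * indicator ?P x) \<in> borel_measurable ?N"
    using f borel_measurable_restrict_space_iff_ennreal[of ?P ?N f] P by (simp add: graph_measure_def)
  have "(\<integral>\<^sup>+x. f x \<partial>graph_measure G len) = (\<integral>\<^sup>+x. f x * indicator ?P x \<partial>?N)"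
    unfolding graph_measure_def by (rule nn_integral_restrict_space) (use P in auto)
  also have "\<dots> = (\<integral>\<^sup>+e. \<integral>\<^sup>+t. f (e, t) * indicator ?P (e, t) \<partial>lborel \<partial>count_space (arcs G))"
    using lborel.nn_integral_fst[OF m] by simp
  also have "\<dots> = (\<Sum>e\<in>arcs G. \<integral>\<^sup>+t. f (e, t) * indicator ?P (e, t) \<partial>lborel)"
    using fin by (rule nn_integral_count_space_finite)
  also have "\<dots> = (\<Sum>e\<in>arcs G. \<integral>\<^sup>+t. f (e, t) * indicator {0..len e} t \<partial>lborel)"
    by (intro sum.cong nn_integral_cong refl) (auto simp: graph_points_def indicator_def)
  finally show ?thesis .
qed

lemma finite_measure_graph_measure:
  assumes "finite (arcs G)"
  shows "finite_measure (graph_measure G len)"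
proof (rule finite_measureI)
  have "emeasure (graph_measure G len) (space (graph_measure G len)) = (\<integral>\<^sup>+x. 1 \<partial>graph_measure G len)"
    by simp
  also have "\<dots> = (\<Sum>e\<in>arcs G. emeasure lborel {0..len e})"
    using nn_integral_graph_measure[OF assms, of "\<lambda>_. 1" len] by simp
  also have "\<dots> \<noteq> \<infinity>"
    using assms by (simp add: emeasure_lborel_Icc_eq)
  finally show "emeasure (graph_measure G len) (space (graph_measure G len)) \<noteq> \<infinity>" .
qed

lemma integral_graph_measure:
  fixes f :: "'e point \<Rightarrow> real"
  assumes fin: "finite (arcs G)" and f: "integrable (graph_measure G len) f"
  shows "(\<integral>x. f x \<partial>graph_measure G len) = (\<Sum>e\<in>arcs G. LBINT t:{0..len e}. f (e, t))"
proof -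
  let ?N = "count_space (arcs G) \<Otimes>\<^sub>M lborel" and ?P = "graph_points G len"
  interpret pair_sigma_finite "count_space (arcs G)" "lborel :: real measure"
    using fin by (rule pair_sigma_finite_graph)
  have P: "?P \<inter> space ?N \<in> sets ?N" using graph_points_measurable[OF fin, of len] by auto
  have int: "integrable ?N (\<lambda>x. indicator ?P x *\<^sub>R f x)"
    using f integrable_restrict_space[OF P, of f] by (simp add: graph_measure_def)
  have "(\<integral>x. f x \<partial>graph_measure G len) = (\<integral>x. indicator ?P x *\<^sub>R f x \<partial>?N)"
    unfolding graph_measure_def by (rule integral_restrict_space[OF P])
  also have "\<dots> = (\<integral>e. (\<integral>t. indicator ?P (e, t) *\<^sub>R f (e, t) \<partial>lborel) \<partial>count_space (arcs G))"
    by (rule integral_fst'[OF int, symmetric])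
  also have "\<dots> = (\<Sum>e\<in>arcs G. \<integral>t. indicator ?P (e, t) *\<^sub>R f (e, t) \<partial>lborel)"
    using fin by (rule lebesgue_integral_count_space_finite)
  also have "\<dots> = (\<Sum>e\<in>arcs G. LBINT t:{0..len e}. f (e, t))"
    unfolding set_lebesgue_integral_def
    by (intro sum.cong Bochner_Integration.integral_cong refl) (auto simp: graph_points_def indicator_def)
  finally show ?thesis .
qed

text \<open>
  Equations in \<open>L\<^sub>2\<close> of the graph can be read edge by edge.
\<close>

lemma AE_graph_measure_edge:
  assumes fin: "finite (arcs G)" and P: "AE x in graph_measure G len. P x" and e: "e \<in> arcs G"
  shows "AE t in lborel. t \<in> {0..len e} \<longrightarrow> P (e, t)"
proof -
  interpret pair_sigma_finite "count_space (arcs G)" "lborel :: real measure"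
    using fin by (rule pair_sigma_finite_graph)
  have "graph_points G len \<inter> space (count_space (arcs G) \<Otimes>\<^sub>M lborel) \<in> sets (count_space (arcs G) \<Otimes>\<^sub>M lborel)"
    using graph_points_measurable[OF fin, of len] by auto
  then have "AE x in count_space (arcs G) \<Otimes>\<^sub>M lborel. x \<in> graph_points G len \<longrightarrow> P x"
    using P unfolding graph_measure_def by (simp add: AE_restrict_space_iff)
  from AE_pair[OF this] have "AE t in lborel. (e, t) \<in> graph_points G len \<longrightarrow> P (e, t)"
    using e by (simp add: AE_count_space)
  then show ?thesis using e by (auto simp: graph_points_def)
qed

lemma measurable_graph_measureI:
  assumes fin: "finite (arcs G)"
    and f: "\<And>e. e \<in> arcs G \<Longrightarrow> (\<lambda>t. f (e, t)) \<in> measurable lborel N"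
  shows "f \<in> measurable (graph_measure G len) N"
  unfolding graph_measure_def
  by (intro measurable_restrict_space1 measurable_pair_measure_countable1 countable_finite fin f)

lemma measurable_into_graph_measure:
  assumes e: "e \<in> arcs G" and f: "f \<in> borel_measurable N"
  shows "(\<lambda>x. (e, f x)) \<in> measurable N (count_space (arcs G) \<Otimes>\<^sub>M lborel)"
  using e f by (intro measurable_Pair) auto


lemma AE_graph_measure_neq:
  assumes fin: "finite (arcs G)"
  shows "AE x in graph_measure G len. x \<noteq> x0"
proof (cases "fst x0 \<in> arcs G")
  case False
  then show ?thesis by (intro AE_I2) (auto simp: space_graph_measure graph_points_def)
next
  case True
  interpret pair_sigma_finite "count_space (arcs G)" "lborel :: real measure"
    using fin by (rule pair_sigma_finite_graph)
  let ?N = "count_space (arcs G) \<Otimes>\<^sub>M (lborel :: real measure)"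
  have "{fst x0} \<times> {snd x0} \<in> sets ?N"
    using True by (intro pair_measureI) auto
  then have single: "{x0} \<in> sets ?N" by simp
  have "AE x in ?N. x \<noteq> x0"
  proof (rule AE_pair_measure)
    have "{x \<in> space ?N. x \<noteq> x0} = space ?N - {x0}" by auto
    then show "{x \<in> space ?N. x \<noteq> x0} \<in> sets ?N" using single by simp
    have "AE t in lborel. (e, t) \<noteq> x0" for e
      using AE_lborel_singleton[of "snd x0"] by eventually_elim auto
    then show "AE e in count_space (arcs G). AE t in lborel. (e, t) \<noteq> x0" by simp
  qed
  then have "AE x in ?N. x \<in> graph_points G len \<longrightarrow> x \<noteq> x0" by (rule eventually_mono) simp
  then show ?thesis
    using graph_points_measurable[OF fin, of len]
    unfolding graph_measure_def by (subst AE_restrict_space_iff) auto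
qed

section \<open>Kirchhoff eigenfunctions and Green's identity\<close>

text \<open>
  On each closed edge \<open>f'' = c f\<close> in the classical sense, with one-sided derivatives at the ends. The
  Kirchhoff condition is tested against an arbitrary function \<open>w\<close> on the vertices: written as a sum over
  edges instead of vertices, it is the boundary term in Green's identity, and two edges can be merged
  in it without distinguishing vertices.
\<close>

definition classical_eigenfunction ::
  "('v, 'e) pre_digraph \<Rightarrow> ('e \<Rightarrow> real) \<Rightarrow> real \<Rightarrow> ('e point \<Rightarrow> real) \<Rightarrow> bool" where
  "classical_eigenfunction G len c f \<longleftrightarrow> (\<exists>p val.
     (\<forall>e\<in>arcs G. \<forall>t\<in>{0..len e}.
        ((\<lambda>t. f (e, t)) has_real_derivative p e t) (at t within {0..len e}) \<and>
        (p e has_real_derivative c * f (e, t)) (at t within {0..len e})) \<and>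
     (\<forall>e\<in>arcs G. f (e, 0) = val (tail G e) \<and> f (e, len e) = val (head G e)) \<and>
     (\<forall>w. (\<Sum>e\<in>arcs G. w (head G e) * p e (len e) - w (tail G e) * p e 0) = 0))"

text \<open>
  The conditions at the vertices, weighted by \<open>w\<close> and added up, with the sum regrouped by edges.
\<close>

lemma kirchhoff_condition_weighted:
  assumes "wf_digraph G" and fin: "finite (verts G)" "finite (arcs G)"
    and kirchhoff: "kirchhoff_condition G len f"
  shows "(\<Sum>e\<in>arcs G. w (head G e) * edge_deriv len f e (len e) - w (tail G e) * edge_deriv len f e 0) = 0"
proof -
  interpret wf_digraph G by fact
  let ?d = "edge_deriv len f"
  have out: "(\<Sum>x\<in>verts G. w x * (\<Sum>e\<in>out_arcs G x. ?d e 0)) = (\<Sum>e\<in>arcs G. w (tail G e) * ?d e 0)"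
  proof -
    have "(\<Sum>x\<in>verts G. \<Sum>e\<in>{e \<in> arcs G. tail G e = x}. w (tail G e) * ?d e 0)
        = (\<Sum>e\<in>arcs G. w (tail G e) * ?d e 0)"
      by (rule sum.group) (use fin in auto)
    then show ?thesis by (simp add: out_arcs_def sum_distrib_left)
  qed
  have inn: "(\<Sum>x\<in>verts G. w x * (\<Sum>e\<in>in_arcs G x. ?d e (len e))) = (\<Sum>e\<in>arcs G. w (head G e) * ?d e (len e))"
  proof -
    have "(\<Sum>x\<in>verts G. \<Sum>e\<in>{e \<in> arcs G. head G e = x}. w (head G e) * ?d e (len e))
        = (\<Sum>e\<in>arcs G. w (head G e) * ?d e (len e))"
      by (rule sum.group) (use fin in auto)
    then show ?thesis by (simp add: in_arcs_def sum_distrib_left)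
  qed
  have "w x * (\<Sum>e\<in>in_arcs G x. ?d e (len e)) = w x * (\<Sum>e\<in>out_arcs G x. ?d e 0)" if "x \<in> verts G" for x
    using kirchhoff that by (simp add: kirchhoff_condition_def sum_negf)
  then have "(\<Sum>x\<in>verts G. w x * (\<Sum>e\<in>in_arcs G x. ?d e (len e)))
      = (\<Sum>x\<in>verts G. w x * (\<Sum>e\<in>out_arcs G x. ?d e 0))"
    by (rule sum.cong[OF refl])
  then show ?thesis by (simp add: out inn sum_subtractf)
qed

lemma eigenfunction_is_classical:
  assumes wf: "wf_digraph G" and fin: "finite (verts G)" "finite (arcs G)"
    and len: "\<And>e. e \<in> arcs G \<Longrightarrow> 0 < len e"
    and eigen: "whittle_matern_op \<kappa> G len f (\<lambda>x. a * f x)"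
  shows "classical_eigenfunction G len (\<kappa>\<^sup>2 - a) f"
proof -
  obtain g where lap: "kirchhoff_laplacian G len f g"
    and ae: "AE x in graph_measure G len. a * f x = \<kappa>\<^sup>2 * f x - g x"
    using eigen by (auto simp: whittle_matern_op_def)
  have cont: "continuous_on_graph G len f" and kirchhoff: "kirchhoff_condition G len f"
    and weak: "\<And>e. e \<in> arcs G \<Longrightarrow> second_weak_derivative (len e) (\<lambda>t. f (e, t)) (\<lambda>t. g (e, t))"
    using lap by (auto simp: kirchhoff_laplacian_def laplacian_domain_def)
  have "\<exists>p. \<forall>t\<in>{0..len e}. ((\<lambda>t. f (e, t)) has_real_derivative p t) (at t within {0..len e}) \<and>
      (p has_real_derivative (\<kappa>\<^sup>2 - a) * f (e, t)) (at t within {0..len e})" if e: "e \<in> arcs G" for e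
  proof (rule weak_eigenfunction_is_classical[OF len[OF e] weak[OF e]])
    show "continuous_on {0..len e} (\<lambda>t. f (e, t))"
      using cont e by (simp add: continuous_on_graph_def)
    show "AE t in lborel. t \<in> {0..len e} \<longrightarrow> g (e, t) = (\<kappa>\<^sup>2 - a) * f (e, t)"
      using AE_graph_measure_edge[OF fin(2) ae e] by eventually_elim (simp add: algebra_simps)
  qed
  then obtain p where p: "\<And>e t. e \<in> arcs G \<Longrightarrow> t \<in> {0..len e} \<Longrightarrow>
      ((\<lambda>t. f (e, t)) has_real_derivative p e t) (at t within {0..len e}) \<and>
      (p e has_real_derivative (\<kappa>\<^sup>2 - a) * f (e, t)) (at t within {0..len e})"
    by metis
  obtain val where val: "\<forall>e\<in>arcs G. f (e, 0) = val (tail G e) \<and> f (e, len e) = val (head G e)"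
    using cont by (auto simp: continuous_on_graph_def)
  have edge: "edge_deriv len f e t = p e t" if e: "e \<in> arcs G" and t: "t \<in> {0..len e}" for e t
    unfolding edge_deriv_def
    using vector_derivative_within_cbox[of 0 "len e" t "\<lambda>s. f (e, s)" "p e t"] len[OF e] p[OF e t] t
    by (simp add: has_real_derivative_iff_has_vector_derivative)
  have "(\<Sum>e\<in>arcs G. w (head G e) * p e (len e) - w (tail G e) * p e 0) = 0" for w
    using kirchhoff_condition_weighted[OF wf fin kirchhoff, of w] len
    by (simp add: edge less_imp_le cong: sum.cong)
  with p val show ?thesis
    unfolding classical_eigenfunction_def by blast
qed

text \<open>
  The integrand is the derivative of the Wronskian \<open>p g - f q\<close>.
\<close>

lemma Green_identity_interval:
  fixes f g p q :: "real \<Rightarrow> real"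
  assumes "0 \<le> l"
    and f: "\<And>t. t \<in> {0..l} \<Longrightarrow> (f has_real_derivative p t) (at t within {0..l})"
    and p: "\<And>t. t \<in> {0..l} \<Longrightarrow> (p has_real_derivative c * f t) (at t within {0..l})"
    and g: "\<And>t. t \<in> {0..l} \<Longrightarrow> (g has_real_derivative q t) (at t within {0..l})"
    and q: "\<And>t. t \<in> {0..l} \<Longrightarrow> (q has_real_derivative d * g t) (at t within {0..l})"
  shows "(c - d) * (LBINT t:{0..l}. f t * g t) = (p l * g l - f l * q l) - (p 0 * g 0 - f 0 * q 0)"
proof -
  have "(LBINT t:{0..l}. (c - d) * (f t * g t)) = (p l * g l - f l * q l) - (p 0 * g 0 - f 0 * q 0)"
    unfolding set_lebesgue_integral_def
  proof (rule integral_FTC_Icc)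
    show "((\<lambda>t. p t * g t - f t * q t) has_vector_derivative (c - d) * (f t * g t)) (at t within {0..l})"
      if "0 \<le> t" "t \<le> l" for t
    proof -
      have "((\<lambda>t. p t * g t - f t * q t) has_real_derivative
          (c * f t * g t + q t * p t) - (p t * q t + d * g t * f t)) (at t within {0..l})"
        using that by (intro DERIV_diff DERIV_mult f p g q) auto
      moreover have "(c * f t * g t + q t * p t) - (p t * q t + d * g t * f t) = (c - d) * (f t * g t)"
        by (simp add: algebra_simps)
      ultimately show ?thesis by (simp add: has_real_derivative_iff_has_vector_derivative)
    qed
    show "continuous_on {0..l} (\<lambda>t. (c - d) * (f t * g t))"
      by (intro continuous_intros DERIV_continuous_on[OF f] DERIV_continuous_on[OF g])
  qed fact
  then show ?thesis by simp
qed

text \<open>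
  Adding Green's identity over the edges, the boundary terms become the weighted Kirchhoff condition of
  \<open>f\<close>, tested against the vertex values of \<open>g\<close>, minus the one with the roles exchanged. Both vanish.
\<close>

lemma classical_eigenfunctions_orthogonal:
  assumes fin: "finite (arcs G)" and len: "\<And>e. e \<in> arcs G \<Longrightarrow> 0 < len e"
    and f: "classical_eigenfunction G len c f" and g: "classical_eigenfunction G len d g"
    and int: "integrable (graph_measure G len) (\<lambda>x. f x * g x)" and "c \<noteq> d"
  shows "L2_inner (graph_measure G len) f g = 0"
proof -
  obtain p val where p: "\<And>e t. e \<in> arcs G \<Longrightarrow> t \<in> {0..len e} \<Longrightarrow>
        ((\<lambda>t. f (e, t)) has_real_derivative p e t) (at t within {0..len e}) \<and>
        (p e has_real_derivative c * f (e, t)) (at t within {0..len e})"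
    and val: "\<And>e. e \<in> arcs G \<Longrightarrow> f (e, 0) = val (tail G e) \<and> f (e, len e) = val (head G e)"
    and flux: "\<And>w. (\<Sum>e\<in>arcs G. w (head G e) * p e (len e) - w (tail G e) * p e 0) = 0"
    using f unfolding classical_eigenfunction_def by blast
  obtain q val' where q: "\<And>e t. e \<in> arcs G \<Longrightarrow> t \<in> {0..len e} \<Longrightarrow>
        ((\<lambda>t. g (e, t)) has_real_derivative q e t) (at t within {0..len e}) \<and>
        (q e has_real_derivative d * g (e, t)) (at t within {0..len e})"
    and val': "\<And>e. e \<in> arcs G \<Longrightarrow> g (e, 0) = val' (tail G e) \<and> g (e, len e) = val' (head G e)"
    and flux': "\<And>w. (\<Sum>e\<in>arcs G. w (head G e) * q e (len e) - w (tail G e) * q e 0) = 0"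
    using g unfolding classical_eigenfunction_def by blast
  have "(c - d) * L2_inner (graph_measure G len) f g
      = (\<Sum>e\<in>arcs G. (c - d) * (LBINT t:{0..len e}. f (e, t) * g (e, t)))"
    unfolding L2_inner_def integral_graph_measure[OF fin int] by (simp add: sum_distrib_left)
  also have "\<dots> = (\<Sum>e\<in>arcs G. (val' (head G e) * p e (len e) - val' (tail G e) * p e 0)
      - (val (head G e) * q e (len e) - val (tail G e) * q e 0))"
  proof (rule sum.cong[OF refl])
    fix e assume e: "e \<in> arcs G"
    have "(c - d) * (LBINT t:{0..len e}. f (e, t) * g (e, t))
        = (p e (len e) * g (e, len e) - f (e, len e) * q e (len e)) - (p e 0 * g (e, 0) - f (e, 0) * q e 0)"
      using len[OF e] p[OF e] q[OF e] by (intro Green_identity_interval) auto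
    then show "(c - d) * (LBINT t:{0..len e}. f (e, t) * g (e, t))
        = (val' (head G e) * p e (len e) - val' (tail G e) * p e 0)
          - (val (head G e) * q e (len e) - val (tail G e) * q e 0)"
      using val[OF e] val'[OF e] by (simp add: algebra_simps)
  qed
  also have "\<dots> = 0"
    using flux[of val'] flux'[of val] by (simp add: sum_subtractf)
  finally show ?thesis using \<open>c \<noteq> d\<close> by simp
qed

section \<open>Removing a vertex of degree two\<close>

lemma has_real_derivative_affine_within:
  assumes F: "\<And>x. x \<in> {0..L} \<Longrightarrow> (F has_real_derivative P x) (at x within {0..L})"
    and into: "\<And>t. t \<in> {0..m} \<Longrightarrow> a + s * t \<in> {0..L}" and t: "t \<in> {0..m}"
  shows "((\<lambda>t. F (a + s * t)) has_real_derivative s * P (a + s * t)) (at t within {0..m})"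
proof -
  have "((\<lambda>t. a + s * t) has_real_derivative s) (at t within {0..m})"
    by (auto intro!: derivative_eq_intros)
  moreover have "(F has_real_derivative P (a + s * t)) (at (a + s * t) within (\<lambda>t. a + s * t) ` {0..m})"
    by (rule has_field_derivative_subset[OF F[OF into[OF t]]]) (use into in auto)
  ultimately have "(F \<circ> (\<lambda>t. a + s * t) has_real_derivative P (a + s * t) * s) (at t within {0..m})"
    by (rule DERIV_image_chain[rotated])
  then show ?thesis by (simp add: o_def mult.commute)
qed

lemma nn_integral_lborel_affine_unit:
  fixes h :: "real \<Rightarrow> ennreal"
  assumes "h \<in> borel_measurable borel" "\<bar>s\<bar> = 1"
  shows "(\<integral>\<^sup>+t. h (a + s * t) \<partial>lborel) = (\<integral>\<^sup>+t. h t \<partial>lborel)"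
  using nn_integral_real_affine[OF assms(1), of s a] assms(2) by auto

locale degree_two_vertex = compact_metric_graph G len
  for G :: "('v, 'e) pre_digraph" and len :: "'e \<Rightarrow> real" +
  fixes v :: 'v and k l :: 'e
  assumes degree: "in_degree G v + out_degree G v = 2"
    and distinct: "k \<noteq> l" and incident: "incident G k v" "incident G l v"
begin

abbreviation "G' \<equiv> merge_graph G v k l"
abbreviation "len' \<equiv> merge_len len k l"
abbreviation "\<iota> \<equiv> merge_point G len v k l"

lemma k_arc: "k \<in> arcs G" and l_arc: "l \<in> arcs G"
  using incident by (auto simp: incident_def)

text \<open>
  The degree counts edge ends: with each arc tagged by the end at which it meets \<open>v\<close>, there are exactly
  two tagged arcs. The arcs \<open>k\<close> and \<open>l\<close> provide one each, so neither of them is a loop and no other arc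
  meets \<open>v\<close>.
\<close>

lemma degree_two_incidence:
  shows "tail G k = v \<longleftrightarrow> head G k \<noteq> v" and "tail G l = v \<longleftrightarrow> head G l \<noteq> v"
    and "\<And>e. e \<in> arcs G \<Longrightarrow> e \<noteq> k \<Longrightarrow> e \<noteq> l \<Longrightarrow> tail G e \<noteq> v \<and> head G e \<noteq> v"
proof -
  let ?E = "(\<lambda>e. (e, True)) ` in_arcs G v \<union> (\<lambda>e. (e, False)) ` out_arcs G v"
  have fin': "finite (in_arcs G v)" "finite (out_arcs G v)"
    by (rule finite_subset[OF _ finite_arcs]; auto)+
  then have fin: "finite ?E" by simp
  have "card ?E = card ((\<lambda>e. (e, True)) ` in_arcs G v) + card ((\<lambda>e. (e, False)) ` out_arcs G v)"
    using fin' by (intro card_Un_disjoint) auto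
  also have "\<dots> = 2"
    using degree by (simp add: card_image inj_on_def in_degree_def out_degree_def)
  finally have card: "card ?E = 2" .
  have no_three: False if "a \<in> ?E" "b \<in> ?E" "c \<in> ?E" "a \<noteq> b" "a \<noteq> c" "b \<noteq> c" for a b c
  proof -
    have "card {a, b, c} \<le> card ?E" using that fin by (intro card_mono) auto
    then show False using card that by simp
  qed
  have ends: "\<exists>x. (e, x) \<in> ?E" if "incident G e v" for e
  proof (cases "head G e = v")
    case True
    then have "(e, True) \<in> ?E" using that by (auto simp: incident_def)
    then show ?thesis by blast
  next
    case False
    then have "(e, False) \<in> ?E" using that by (auto simp: incident_def)
    then show ?thesis by blast
  qed
  obtain x y where x: "(k, x) \<in> ?E" and y: "(l, y) \<in> ?E"
    using ends[OF incident(1)] ends[OF incident(2)] by blast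
  show "tail G k = v \<longleftrightarrow> head G k \<noteq> v"
    using no_three[of "(k, True)" "(k, False)" "(l, y)"] y incident(1) distinct by (auto simp: incident_def)
  show "tail G l = v \<longleftrightarrow> head G l \<noteq> v"
    using no_three[of "(l, True)" "(l, False)" "(k, x)"] x incident(2) distinct by (auto simp: incident_def)
  show "tail G e \<noteq> v \<and> head G e \<noteq> v" if e: "e \<in> arcs G" "e \<noteq> k" "e \<noteq> l" for e
    using no_three[of "(k, x)" "(l, y)" "(e, True)"] no_three[of "(k, x)" "(l, y)" "(e, False)"]
      x y e distinct by auto
qed

lemma arcs_merge: "arcs G' = arcs G - {l}"
  by (simp add: merge_graph_def)

lemma len_merge_pos: "e \<in> arcs G' \<Longrightarrow> 0 < len' e"
  using len_pos[OF k_arc] len_pos[OF l_arc] len_pos by (auto simp: merge_graph_def merge_len_def)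

lemma finite_merge: "finite (verts G')" "finite (arcs G')"
  by (auto simp: merge_graph_def)

lemma wf_merge: "wf_digraph G'"
proof
  fix e assume e: "e \<in> arcs G'"
  show "tail G' e \<in> verts G'" "head G' e \<in> verts G'"
    using e degree_two_incidence k_arc l_arc distinct
    by (auto simp: merge_graph_def other_end_def)
qed

text \<open>
  The identification of points is affine on each edge, \<open>t \<mapsto> offset + orientation * t\<close> into the target
  arc, with \<open>orientation\<close> equal to 1 or -1. This form treats the four possible directions of \<open>k\<close> and \<open>l\<close>
  uniformly.
\<close>

definition target_arc :: "'e \<Rightarrow> 'e" where
  "target_arc e = (if e = l then k else e)"

definition orientation :: "'e \<Rightarrow> real" where
  "orientation e = (if e = k \<and> head G k \<noteq> v \<or> e = l \<and> tail G l \<noteq> v then -1 else 1)"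

definition offset :: "'e \<Rightarrow> real" where
  "offset e =
     (if e = k then if head G k = v then 0 else len k
      else if e = l then if tail G l = v then len k else len k + len l
      else 0)"

lemma merge_point_affine: "\<iota> (e, t) = (target_arc e, offset e + orientation e * t)"
  using distinct by (auto simp: merge_point_def target_arc_def orientation_def offset_def)

lemma target_arc: "e \<in> arcs G \<Longrightarrow> target_arc e \<in> arcs G'"
  using k_arc distinct by (auto simp: target_arc_def arcs_merge)

lemma offset_range: "e \<in> arcs G \<Longrightarrow> t \<in> {0..len e} \<Longrightarrow> offset e + orientation e * t \<in> {0..len' (target_arc e)}"
  using len_pos[OF k_arc] len_pos[OF l_arc] distinct
  by (auto simp: target_arc_def orientation_def offset_def merge_len_def)

lemma orientation_square: "orientation e * orientation e = 1"
  by (simp add: orientation_def)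

text \<open>
  The differential equation on the pieces is the chain rule; the orientation enters twice and squares
  to 1. The removed vertex receives the value at the junction, and there the derivatives of the two
  pieces pointing away from it are opposite, so its contribution to the weighted Kirchhoff condition
  cancels and the condition of the merged graph remains.
\<close>

lemma classical_eigenfunction_pullback:
  assumes "classical_eigenfunction G' len' c f"
  shows "classical_eigenfunction G len c (\<lambda>x. f (\<iota> x))"
proof -
  obtain p val where p: "\<And>e t. e \<in> arcs G' \<Longrightarrow> t \<in> {0..len' e} \<Longrightarrow>
        ((\<lambda>t. f (e, t)) has_real_derivative p e t) (at t within {0..len' e}) \<and>
        (p e has_real_derivative c * f (e, t)) (at t within {0..len' e})"
    and val: "\<And>e. e \<in> arcs G' \<Longrightarrow> f (e, 0) = val (tail G' e) \<and> f (e, len' e) = val (head G' e)"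
    and flux: "\<And>w. (\<Sum>e\<in>arcs G'. w (head G' e) * p e (len' e) - w (tail G' e) * p e 0) = 0"
    using assms unfolding classical_eigenfunction_def by blast
  define q where "q e t = orientation e * p (target_arc e) (offset e + orientation e * t)" for e t
  define val' where "val' = val(v := f (k, len k))"
  have derivs: "((\<lambda>t. f (\<iota> (e, t))) has_real_derivative q e t) (at t within {0..len e}) \<and>
      (q e has_real_derivative c * f (\<iota> (e, t))) (at t within {0..len e})"
    if e: "e \<in> arcs G" and t: "t \<in> {0..len e}" for e t
  proof
    note e' = target_arc[OF e] and into = offset_range[OF e]
    show "((\<lambda>t. f (\<iota> (e, t))) has_real_derivative q e t) (at t within {0..len e})"
      unfolding merge_point_affine q_def
      using p[OF e'] by (intro has_real_derivative_affine_within[OF _ into t, where F = "\<lambda>t. f (target_arc e, t)"]) auto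
    have "((\<lambda>t. p (target_arc e) (offset e + orientation e * t)) has_real_derivative
        orientation e * (c * f (target_arc e, offset e + orientation e * t))) (at t within {0..len e})"
      using p[OF e'] by (intro has_real_derivative_affine_within[OF _ into t]) auto
    from DERIV_cmult[OF this, of "orientation e"]
    show "(q e has_real_derivative c * f (\<iota> (e, t))) (at t within {0..len e})"
      unfolding q_def[abs_def] merge_point_affine mult.assoc[symmetric] orientation_square by simp
  qed
  have k': "k \<in> arcs G'" using k_arc distinct by (simp add: arcs_merge)
  have vals: "f (\<iota> (e, 0)) = val' (tail G e) \<and> f (\<iota> (e, len e)) = val' (head G e)" if e: "e \<in> arcs G" for e
  proof -
    consider "e = k" | "e = l" | "e \<noteq> k" "e \<noteq> l" by blast
    then show ?thesis
    proof cases
      case 1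
      then show ?thesis
        using val[OF k'] degree_two_incidence(1)
        by (auto simp: merge_point_def val'_def merge_graph_def other_end_def)
    next
      case 2
      then show ?thesis
        using val[OF k'] degree_two_incidence(2) distinct
        by (auto simp: merge_point_def val'_def merge_graph_def merge_len_def other_end_def)
    next
      case 3
      then show ?thesis
        using val[of e] e degree_two_incidence(3)[OF e]
        by (auto simp: merge_point_def val'_def merge_graph_def merge_len_def)
    qed
  qed
  have fluxes: "(\<Sum>e\<in>arcs G. w (head G e) * q e (len e) - w (tail G e) * q e 0) = 0" for w
  proof -
    let ?h = "\<lambda>e. w (head G e) * q e (len e) - w (tail G e) * q e 0"
    let ?h' = "\<lambda>e. w (head G' e) * p e (len' e) - w (tail G' e) * p e 0"
    have k: "?h k = w v * p k (len k) - w (other_end G k v) * p k 0"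
      using degree_two_incidence(1) distinct
      by (auto simp: q_def orientation_def offset_def target_arc_def other_end_def)
    have l: "?h l = w (other_end G l v) * p k (len k + len l) - w v * p k (len k)"
      using degree_two_incidence(2) distinct
      by (auto simp: q_def orientation_def offset_def target_arc_def other_end_def)
    have rest: "?h e = ?h' e" if "e \<in> arcs G - {k, l}" for e
      using that by (simp add: q_def orientation_def offset_def target_arc_def merge_graph_def merge_len_def)
    have "(\<Sum>e\<in>arcs G. ?h e) = ?h k + (?h l + (\<Sum>e\<in>arcs G - {k, l}. ?h e))"
      using k_arc l_arc distinct
      by (simp add: sum.remove[of "arcs G" k] sum.remove[of "arcs G - {k}" l] Diff_insert2[symmetric] insert_commute)
    also have "\<dots> = ?h' k + (\<Sum>e\<in>arcs G - {k, l}. ?h' e)"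
      using k l rest by (simp add: merge_graph_def merge_len_def)
    also have "\<dots> = (\<Sum>e\<in>arcs G'. ?h' e)"
      using sum.remove[OF finite_merge(2) k', of ?h'] by (simp add: arcs_merge Diff_insert2[symmetric] insert_commute)
    also have "\<dots> = 0" by (rule flux)
    finally show ?thesis .
  qed
  show ?thesis
    unfolding classical_eigenfunction_def using derivs vals fluxes by blast
qed

lemma merge_point_in_graph_points: "x \<in> graph_points G len \<Longrightarrow> \<iota> x \<in> graph_points G' len'"
  using target_arc offset_range by (cases x) (auto simp: graph_points_def merge_point_affine)

lemma merge_point_measurable: "\<iota> \<in> measurable (graph_measure G len) (graph_measure G' len')"
proof -
  have "\<iota> \<in> measurable (graph_measure G len) (count_space (arcs G') \<Otimes>\<^sub>M lborel)"
    by (rule measurable_graph_measureI)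
      (auto simp: merge_point_affine intro!: measurable_into_graph_measure finite_merge target_arc)
  then show ?thesis
    unfolding graph_measure_def[of G']
    by (rule measurable_restrict_space2[rotated]) (auto simp: space_graph_measure merge_point_in_graph_points)
qed

text \<open>
  The intervals covered by \<open>k\<close> and \<open>l\<close> in the merged edge overlap in the junction only, which is a null
  set, and an affine map with slope 1 or -1 preserves Lebesgue measure.
\<close>

lemma distr_merge_point: "distr (graph_measure G len) (graph_measure G' len') \<iota> = graph_measure G' len'"
proof (rule measure_eqI)
  let ?\<mu> = "graph_measure G len" and ?\<mu>' = "graph_measure G' len'"
  show "sets (distr ?\<mu> ?\<mu>' \<iota>) = sets ?\<mu>'" by simp
  fix A assume "A \<in> sets (distr ?\<mu> ?\<mu>' \<iota>)"
  then have A: "A \<in> sets ?\<mu>'" by simp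
  have k': "k \<in> arcs G'" using k_arc distinct by (simp add: arcs_merge)
  have A': "A \<in> sets (count_space (arcs G') \<Otimes>\<^sub>M lborel)"
    using A graph_points_measurable[OF finite_merge(2), of len']
    by (simp add: graph_measure_def sets_restrict_space_iff)
  have section_meas: "(\<lambda>t. indicator A (e, t) :: ennreal) \<in> borel_measurable borel" if "e \<in> arcs G'" for e
  proof -
    have "(\<lambda>t. (e, t)) \<in> measurable borel (count_space (arcs G') \<Otimes>\<^sub>M lborel)"
      using that by (rule measurable_into_graph_measure) simp
    then show ?thesis
      by (rule measurable_compose) (use A' in simp)
  qed
  define J where "J e = (if e = l then {len k..len k + len l} else {0..len e})" for e
  have J: "offset e + orientation e * t \<in> J e \<longleftrightarrow> t \<in> {0..len e}" for e t
    using distinct by (auto simp: J_def offset_def orientation_def)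
  let ?I = "\<lambda>e. \<integral>\<^sup>+t. indicator A (target_arc e, t) * indicator (J e) t \<partial>lborel"
  have edge: "(\<integral>\<^sup>+t. indicator A (\<iota> (e, t)) * indicator {0..len e} t \<partial>lborel) = ?I e" if e: "e \<in> arcs G" for e
  proof -
    have "(\<lambda>t. indicator A (target_arc e, t) * indicator (J e) t :: ennreal) \<in> borel_measurable borel"
      using section_meas[OF target_arc[OF e]] by (intro borel_measurable_times_ennreal) (auto simp: J_def)
    moreover have "\<bar>orientation e\<bar> = 1" by (simp add: orientation_def)
    moreover have "indicator (J e) (offset e + orientation e * t) = (indicator {0..len e} t :: ennreal)" for t
      using J[of e t] by (simp add: indicator_def)
    ultimately show ?thesis
      using nn_integral_lborel_affine_unit[of "\<lambda>t. indicator A (target_arc e, t) * indicator (J e) t"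
          "orientation e" "offset e"]
      by (simp only: merge_point_affine)
  qed
  have Ik: "?I k + ?I l = (\<integral>\<^sup>+t. indicator A (k, t) * indicator {0..len' k} t \<partial>lborel)"
  proof -
    have "?I k + ?I l = (\<integral>\<^sup>+t. indicator A (k, t) * indicator {0..len k} t
        + indicator A (k, t) * indicator {len k..len k + len l} t \<partial>lborel)"
      using section_meas[OF k'] distinct
      by (subst nn_integral_add) (auto simp: target_arc_def J_def)
    also have "\<dots> = (\<integral>\<^sup>+t. indicator A (k, t) * indicator {0..len' k} t \<partial>lborel)"
    proof (rule nn_integral_cong_AE)
      show "AE t in lborel. indicator A (k, t) * indicator {0..len k} t
          + indicator A (k, t) * indicator {len k..len k + len l} t
          = (indicator A (k, t) * indicator {0..len' k} t :: ennreal)"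
        using AE_lborel_singleton[of "len k"]
        by eventually_elim
          (use len_pos[OF k_arc] len_pos[OF l_arc] in \<open>auto simp: indicator_def merge_len_def\<close>)
    qed
    finally show ?thesis .
  qed
  have "emeasure (distr ?\<mu> ?\<mu>' \<iota>) A = (\<integral>\<^sup>+x. indicator A x \<partial>distr ?\<mu> ?\<mu>' \<iota>)"
    using A by simp
  also have "\<dots> = (\<integral>\<^sup>+x. indicator A (\<iota> x) \<partial>?\<mu>)"
    by (rule nn_integral_distr[OF merge_point_measurable]) (use A in simp)
  also have "\<dots> = (\<Sum>e\<in>arcs G. \<integral>\<^sup>+t. indicator A (\<iota> (e, t)) * indicator {0..len e} t \<partial>lborel)"
    by (rule nn_integral_graph_measure[OF finite_arcs])
      (rule measurable_compose[OF merge_point_measurable], use A in simp)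
  also have "\<dots> = (\<Sum>e\<in>arcs G. ?I e)"
    by (rule sum.cong[OF refl edge])
  also have "\<dots> = ?I k + (?I l + (\<Sum>e\<in>arcs G - {k, l}. ?I e))"
    using k_arc l_arc distinct
    by (simp add: sum.remove[of "arcs G" k] sum.remove[of "arcs G - {k}" l] Diff_insert2[symmetric] insert_commute)
  also have "\<dots> = (\<integral>\<^sup>+t. indicator A (k, t) * indicator {0..len' k} t \<partial>lborel)
      + (\<Sum>e\<in>arcs G' - {k}. \<integral>\<^sup>+t. indicator A (e, t) * indicator {0..len' e} t \<partial>lborel)"
    unfolding add.assoc[symmetric] Ik
    by (intro arg_cong2[where f = plus] refl sum.cong)
      (auto simp: arcs_merge target_arc_def J_def merge_len_def)
  also have "\<dots> = (\<Sum>e\<in>arcs G'. \<integral>\<^sup>+t. indicator A (e, t) * indicator {0..len' e} t \<partial>lborel)"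
    by (rule sum.remove[OF finite_merge(2) k', symmetric])
  also have "\<dots> = (\<integral>\<^sup>+x. indicator A x \<partial>?\<mu>')"
    by (rule nn_integral_graph_measure[OF finite_merge(2), symmetric]) (use A in simp)
  also have "\<dots> = emeasure ?\<mu>' A" using A by simp
  finally show "emeasure (distr ?\<mu> ?\<mu>' \<iota>) A = emeasure ?\<mu>' A" .
qed

text \<open>
  The inverse of the identification. The junction of the merged edge has two preimages; it is sent to
  the arc \<open>k\<close>.
\<close>

definition split_point :: "'e point \<Rightarrow> 'e point" where
  "split_point = (\<lambda>(e, t).
     if e = k then
       if t \<le> len k then (k, if head G k = v then t else len k - t)
       else (l, if tail G l = v then t - len k else len k + len l - t)
     else (e, t))"

lemma split_point_measurable: "split_point \<in> measurable (graph_measure G' len') (graph_measure G len)"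
proof -
  have "split_point \<in> measurable (graph_measure G' len') (count_space (arcs G) \<Otimes>\<^sub>M lborel)"
  proof (rule measurable_graph_measureI[OF finite_merge(2)])
    fix e assume e: "e \<in> arcs G'"
    note into = measurable_into_graph_measure
    show "(\<lambda>t. split_point (e, t)) \<in> measurable lborel (count_space (arcs G) \<Otimes>\<^sub>M lborel)"
    proof (cases "e = k")
      case True
      have "(\<lambda>t. if t \<le> len k then (k, if head G k = v then t else len k - t)
            else (l, if tail G l = v then t - len k else len k + len l - t))
          \<in> measurable lborel (count_space (arcs G) \<Otimes>\<^sub>M lborel)"
        by (intro measurable_If into k_arc l_arc) auto
      then show ?thesis using True by (simp add: split_point_def)
    next
      case False
      then show ?thesis
        using e into[where e = e and f = "\<lambda>t. t"] by (simp add: split_point_def arcs_merge)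
    qed
  qed
  then show ?thesis
    unfolding graph_measure_def[of G len]
  proof (rule measurable_restrict_space2[rotated])
    show "split_point \<in> space (graph_measure G' len') \<rightarrow> graph_points G len"
      using k_arc l_arc
      by (auto simp: space_graph_measure graph_points_def split_point_def arcs_merge merge_len_def split: if_splits)
  qed
qed

lemma split_merge_point: "AE x in graph_measure G len. split_point (\<iota> x) = x"
proof -
  have "AE x in graph_measure G len. x \<noteq> (l, if tail G l = v then 0 else len l)"
    by (rule AE_graph_measure_neq[OF finite_arcs])
  then show ?thesis
    using AE_space
  proof eventually_elim
    case (elim x)
    then show ?case
      using distinct by (cases x) (auto simp: split_point_def merge_point_def space_graph_measure graph_points_def)
  qed
qed

end

section \<open>Invariance of the covariance function\<close>

context degree_two_vertex
begin

lemma eigenvectors_orthogonal: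
  assumes f: "f \<in> L2 (graph_measure G len)" and f': "f' \<in> L2 (graph_measure G' len')"
    and eigen: "whittle_matern_op \<kappa> G len f (\<lambda>x. a * f x)"
    and eigen': "whittle_matern_op \<kappa> G' len' f' (\<lambda>x. b * f' x)" and "a \<noteq> b"
  shows "L2_inner (graph_measure G len) f (\<lambda>x. f' (\<iota> x)) = 0"
proof (rule classical_eigenfunctions_orthogonal[OF finite_arcs len_pos])
  show "classical_eigenfunction G len (\<kappa>\<^sup>2 - a) f"
    by (rule eigenfunction_is_classical[OF wf_digraph_axioms finite_verts finite_arcs len_pos eigen])
  show "classical_eigenfunction G len (\<kappa>\<^sup>2 - b) (\<lambda>x. f' (\<iota> x))"
    by (rule classical_eigenfunction_pullback,
        rule eigenfunction_is_classical[OF wf_merge finite_merge len_merge_pos eigen'])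
  show "integrable (graph_measure G len) (\<lambda>x. f x * f' (\<iota> x))"
    by (rule L2_integrable_mult[OF f L2_pullback[OF merge_point_measurable distr_merge_point f']])
  show "\<kappa>\<^sup>2 - a \<noteq> \<kappa>\<^sup>2 - b" using \<open>a \<noteq> b\<close> by simp
qed

lemma fractional_powers_correspond:
  assumes pow: "fractional_power \<kappa> G len \<beta> \<psi> g" and pow': "fractional_power \<kappa> G' len' \<beta> \<psi>' g'"
    and \<psi>: "AE x in graph_measure G len. \<psi> x = \<psi>' (\<iota> x)"
  shows "AE x in graph_measure G len. g x = g' (\<iota> x)"
proof -
  let ?\<mu> = "graph_measure G len" and ?\<mu>' = "graph_measure G' len'"
  obtain lam \<phi> where basis: "orthonormal_basis ?\<mu> \<phi>"
    and eigen: "\<And>i. whittle_matern_op \<kappa> G len (\<phi> i) (\<lambda>x. lam i * \<phi> i x)"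
    and sums: "L2_sums ?\<mu> (\<lambda>i x. lam i powr \<beta> * L2_inner ?\<mu> \<psi> (\<phi> i) * \<phi> i x) g"
    and L2: "\<psi> \<in> L2 ?\<mu>" "g \<in> L2 ?\<mu>"
    using pow by (auto simp: fractional_power_def eigenbasis_def)
  obtain lam' \<phi>' where basis': "orthonormal_basis ?\<mu>' \<phi>'"
    and eigen': "\<And>i. whittle_matern_op \<kappa> G' len' (\<phi>' i) (\<lambda>x. lam' i * \<phi>' i x)"
    and sums': "L2_sums ?\<mu>' (\<lambda>i x. lam' i powr \<beta> * L2_inner ?\<mu>' \<psi>' (\<phi>' i) * \<phi>' i x) g'"
    and L2': "\<psi>' \<in> L2 ?\<mu>'" "g' \<in> L2 ?\<mu>'"
    using pow' by (auto simp: fractional_power_def eigenbasis_def)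
  have "L2_inner ?\<mu> (\<phi> i) (\<lambda>x. \<phi>' j (\<iota> x)) = 0" if "lam i \<noteq> lam' j" for i j
    using basis basis' eigen eigen' that
    by (intro eigenvectors_orthogonal) (auto simp: orthonormal_basis_def)
  then show ?thesis
    by (rule spectral_functions_correspond[where F = "\<lambda>x. x powr \<beta>",
          OF merge_point_measurable distr_merge_point basis basis' _ L2(1) L2'(1) \<psi> L2(2) L2'(2) sums sums'])
qed

end

lemma whittle_matern_solutionD:
  assumes sol: "whittle_matern_solution M W \<kappa> \<tau> \<alpha> G len u" and \<psi>: "\<psi> \<in> L2 (graph_measure G len)"
  shows "centered_gaussian M (\<lambda>\<omega>. L2_inner (graph_measure G len) (u \<omega>) \<psi>)"
    and "(\<lambda>\<omega>. L2_inner (graph_measure G len) (u \<omega>) \<psi>) \<in> borel_measurable M"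
    and "\<exists>g. fractional_power \<kappa> G len (- \<alpha> / 2) \<psi> g \<and>
      (AE \<omega> in M. L2_inner (graph_measure G len) (u \<omega>) \<psi> = W (\<lambda>x. inverse \<tau> * g x) \<omega>)"
proof -
  note * = sol[unfolded whittle_matern_solution_def, THEN conjunct2, THEN bspec, OF \<psi>]
  show "centered_gaussian M (\<lambda>\<omega>. L2_inner (graph_measure G len) (u \<omega>) \<psi>)"
    using * by (rule conjunct1)
  then show "(\<lambda>\<omega>. L2_inner (graph_measure G len) (u \<omega>) \<psi>) \<in> borel_measurable M"
    by (simp only: centered_gaussian_def)
  show "\<exists>g. fractional_power \<kappa> G len (- \<alpha> / 2) \<psi> g \<and>
      (AE \<omega> in M. L2_inner (graph_measure G len) (u \<omega>) \<psi> = W (\<lambda>x. inverse \<tau> * g x) \<omega>)"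
    using * by (rule conjunct2)
qed

lemma white_noise_image_covariance:
  assumes noise: "gaussian_white_noise M \<mu> W" and L2: "g \<in> L2 \<mu>" "h \<in> L2 \<mu>"
    and X: "X \<in> borel_measurable M" "AE \<omega> in M. X \<omega> = W (\<lambda>x. c * g x) \<omega>"
    and Y: "Y \<in> borel_measurable M" "AE \<omega> in M. Y \<omega> = W (\<lambda>x. c * h x) \<omega>"
  shows "(\<integral>\<omega>. X \<omega> * Y \<omega> \<partial>M) = c * c * L2_inner \<mu> g h"
proof -
  have W_meas: "W f \<in> borel_measurable M" if "f \<in> L2 \<mu>" for f
  proof -
    have "centered_gaussian M (\<lambda>\<omega>. \<Sum>h\<in>{f}. 1 * W h \<omega>)"
      using noise[unfolded gaussian_white_noise_def, THEN conjunct2, THEN conjunct1, rule_format,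
          of "{f}" "\<lambda>_. 1"] that by simp
    then show ?thesis by (simp add: centered_gaussian_def)
  qed
  note cg = L2_scale[OF L2(1), of c] and ch = L2_scale[OF L2(2), of c]
  have "(\<integral>\<omega>. X \<omega> * Y \<omega> \<partial>M) = (\<integral>\<omega>. W (\<lambda>x. c * g x) \<omega> * W (\<lambda>x. c * h x) \<omega> \<partial>M)"
  proof (rule integral_cong_AE)
    show "AE \<omega> in M. X \<omega> * Y \<omega> = W (\<lambda>x. c * g x) \<omega> * W (\<lambda>x. c * h x) \<omega>"
      using X(2) Y(2) by eventually_elim simp
  qed (use X(1) Y(1) W_meas[OF cg] W_meas[OF ch] in auto)
  also have "\<dots> = L2_inner \<mu> (\<lambda>x. c * g x) (\<lambda>x. c * h x)"
    using noise cg ch by (simp add: gaussian_white_noise_def)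
  also have "\<dots> = c * c * L2_inner \<mu> g h"
    by (simp add: L2_inner_scale L2_inner_commute[of \<mu> g "\<lambda>x. c * h x"] L2_inner_commute[of \<mu> h g])
  finally show ?thesis .
qed

text \<open>
  The definition of a solution provides an eigenbasis, since fractional powers are defined through one,
  and the coordinates of \<open>u\<close> in it are Gaussian.
\<close>

lemma whittle_matern_solution_square_integrable:
  assumes noise: "gaussian_white_noise M (graph_measure G len) W"
    and sol: "whittle_matern_solution M W \<kappa> \<tau> \<alpha> G len u"
  shows "integrable M (\<lambda>\<omega>. L2_inner (graph_measure G len) (u \<omega>) (u \<omega>))"
proof -
  interpret prob_space M using noise by (simp add: gaussian_white_noise_def)
  have rv: "L2_random_variable M (graph_measure G len) u"
    using sol by (simp add: whittle_matern_solution_def)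
  obtain g where "fractional_power \<kappa> G len (- \<alpha> / 2) (\<lambda>x. 0) g"
    using whittle_matern_solutionD(3)[OF sol L2_zero] by blast
  then obtain \<phi> where basis: "orthonormal_basis (graph_measure G len) \<phi>"
    unfolding fractional_power_def eigenbasis_def by blast
  show ?thesis
  proof (rule gaussian_L2_variable_square_integrable[OF basis])
    show "u \<omega> \<in> L2 (graph_measure G len)" if "\<omega> \<in> space M" for \<omega>
      using rv that by (simp add: L2_random_variable_def)
    show "centered_gaussian M (\<lambda>\<omega>. L2_inner (graph_measure G len) (u \<omega>) (\<phi> i))" for i
      using basis by (intro whittle_matern_solutionD(1)[OF sol]) (simp add: orthonormal_basis_def)
  qed
qed

text \<open>
  Both fields are regarded as random elements of \<open>L\<^sub>2\<close> of the original graph, the second one through the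
  pullback \<open>v'\<close>. For indicators of measurable sets, \<open>E[(u,A)(u,B)]\<close> is the inner product of the images of
  the indicators under \<open>\<tau>\<^sup>-\<^sup>1 L\<^sup>-\<^sup>\<alpha>\<^sup>/\<^sup>2\<close>, and these images correspond under \<open>\<iota>\<close>.
\<close>

lemma (in degree_two_vertex) covariance_invariant:
  assumes noise: "gaussian_white_noise M (graph_measure G len) W"
    and sol: "whittle_matern_solution M W \<kappa> \<tau> \<alpha> G len u"
    and noise': "gaussian_white_noise M' (graph_measure G' len') W'"
    and sol': "whittle_matern_solution M' W' \<kappa> \<tau> \<alpha> G' len' u'"
  shows "AE (s, s') in graph_measure G len \<Otimes>\<^sub>M graph_measure G len.
           integrable M (\<lambda>\<omega>. u \<omega> s * u \<omega> s') \<and>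
           integrable M' (\<lambda>\<omega>. u' \<omega> (\<iota> s) * u' \<omega> (\<iota> s')) \<and>
           covariance_fun M u s s' = covariance_fun M' u' (\<iota> s) (\<iota> s')"
proof -
  let ?\<mu> = "graph_measure G len" and ?\<mu>' = "graph_measure G' len'"
  interpret M: prob_space M using noise by (simp add: gaussian_white_noise_def)
  interpret M': prob_space M' using noise' by (simp add: gaussian_white_noise_def)
  interpret \<mu>: finite_measure ?\<mu> by (rule finite_measure_graph_measure[OF finite_arcs])
  note \<iota> = merge_point_measurable and distr = distr_merge_point
  define v' where "v' \<omega> x = u' \<omega> (\<iota> x)" for \<omega> x
  have rv: "L2_random_variable M ?\<mu> u" and rv': "L2_random_variable M' ?\<mu>' u'"
    using sol sol' by (auto simp: whittle_matern_solution_def)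
  have u': "u' \<omega> \<in> L2 ?\<mu>'" if "\<omega> \<in> space M'" for \<omega>
    using rv' that by (simp add: L2_random_variable_def)
  have rvv: "L2_random_variable M' ?\<mu> v'"
    unfolding L2_random_variable_def
  proof
    have "(\<lambda>(\<omega>, x). (\<omega>, \<iota> x)) \<in> measurable (M' \<Otimes>\<^sub>M ?\<mu>) (M' \<Otimes>\<^sub>M ?\<mu>')"
      using \<iota> by measurable
    moreover have "(\<lambda>(\<omega>, x). u' \<omega> x) \<in> borel_measurable (M' \<Otimes>\<^sub>M ?\<mu>')"
      using rv' by (simp add: L2_random_variable_def)
    ultimately have "(\<lambda>p. (\<lambda>(\<omega>, x). u' \<omega> x) ((\<lambda>(\<omega>, x). (\<omega>, \<iota> x)) p)) \<in> borel_measurable (M' \<Otimes>\<^sub>M ?\<mu>)"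
      by (rule measurable_compose)
    then show "(\<lambda>(\<omega>, x). v' \<omega> x) \<in> borel_measurable (M' \<Otimes>\<^sub>M ?\<mu>)"
      by (simp add: v'_def case_prod_beta')
    show "\<forall>\<omega>\<in>space M'. v' \<omega> \<in> L2 ?\<mu>"
      using L2_pullback[OF \<iota> distr u'] by (simp add: v'_def[abs_def])
  qed
  have sq: "integrable M (\<lambda>\<omega>. L2_inner ?\<mu> (u \<omega>) (u \<omega>))"
    by (rule whittle_matern_solution_square_integrable[OF noise sol])
  have "integrable M' (\<lambda>\<omega>. L2_inner ?\<mu>' (u' \<omega>) (u' \<omega>))"
    by (rule whittle_matern_solution_square_integrable[OF noise' sol'])
  then have sqv: "integrable M' (\<lambda>\<omega>. L2_inner ?\<mu> (v' \<omega>) (v' \<omega>))"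
    by (rule Bochner_Integration.integrable_cong[THEN iffD1, OF refl, rotated])
      (simp add: v'_def[abs_def] L2_inner_pullback[OF \<iota> distr u' u'])
  note K = second_moment_kernel[OF M.prob_space_axioms \<mu>.finite_measure_axioms rv sq]
  note K' = second_moment_kernel[OF M'.prob_space_axioms \<mu>.finite_measure_axioms rvv sqv]
  have moments: "(\<integral>\<omega>. L2_inner ?\<mu> (u \<omega>) (indicator A) * L2_inner ?\<mu> (u \<omega>) (indicator B) \<partial>M)
      = (\<integral>\<omega>. L2_inner ?\<mu> (v' \<omega>) (indicator A) * L2_inner ?\<mu> (v' \<omega>) (indicator B) \<partial>M')"
    if A: "A \<in> sets ?\<mu>" and B: "B \<in> sets ?\<mu>" for A B
  proof -
    \<comment> \<open>The indicator transported to the merged graph.\<close>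
    define chi :: "'e point set \<Rightarrow> 'e point \<Rightarrow> real" where "chi C x = indicator C (split_point x)" for C x
    have ind: "(indicator C :: _ \<Rightarrow> real) \<in> L2 ?\<mu>" if "C \<in> sets ?\<mu>" for C
      by (rule L2_bounded[OF \<mu>.finite_measure_axioms]) (use that in \<open>auto simp: indicator_def\<close>)
    have chi: "chi C \<in> L2 ?\<mu>'" if "C \<in> sets ?\<mu>" for C
    proof (rule L2_bounded[OF finite_measure_graph_measure[OF finite_merge(2)]])
      show "chi C \<in> borel_measurable ?\<mu>'"
        unfolding chi_def[abs_def]
        by (rule measurable_compose[OF split_point_measurable borel_measurable_indicator[OF that]])
    qed (simp add: chi_def indicator_def)
    have chi_AE: "AE x in ?\<mu>. indicator C x = chi C (\<iota> x)" for C
      using split_merge_point by eventually_elim (simp add: chi_def)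
    have inner_chi: "L2_inner ?\<mu> (v' \<omega>) (indicator C) = L2_inner ?\<mu>' (u' \<omega>) (chi C)"
      if "\<omega> \<in> space M'" "C \<in> sets ?\<mu>" for \<omega> C
    proof -
      note pull = L2_pullback[OF \<iota> distr]
      have "L2_inner ?\<mu> (indicator C) (\<lambda>x. u' \<omega> (\<iota> x)) = L2_inner ?\<mu> (\<lambda>x. chi C (\<iota> x)) (\<lambda>x. u' \<omega> (\<iota> x))"
        using L2_measurable[OF ind[OF that(2)]] L2_measurable[OF pull[OF chi[OF that(2)]]]
          L2_measurable[OF pull[OF u'[OF that(1)]]] chi_AE
        by (rule L2_inner_cong_AE)
      then show ?thesis
        using L2_inner_pullback[OF \<iota> distr chi[OF that(2)] u'[OF that(1)]]
        by (simp add: v'_def[abs_def] L2_inner_commute[of ?\<mu> _ "indicator C"] L2_inner_commute[of ?\<mu>' _ "chi C"])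
    qed
    obtain a where a: "fractional_power \<kappa> G len (- \<alpha> / 2) (indicator A) a"
        "AE \<omega> in M. L2_inner ?\<mu> (u \<omega>) (indicator A) = W (\<lambda>x. inverse \<tau> * a x) \<omega>"
      using whittle_matern_solutionD(3)[OF sol ind[OF A]] by blast
    obtain b where b: "fractional_power \<kappa> G len (- \<alpha> / 2) (indicator B) b"
        "AE \<omega> in M. L2_inner ?\<mu> (u \<omega>) (indicator B) = W (\<lambda>x. inverse \<tau> * b x) \<omega>"
      using whittle_matern_solutionD(3)[OF sol ind[OF B]] by blast
    obtain a' where a': "fractional_power \<kappa> G' len' (- \<alpha> / 2) (chi A) a'"
        "AE \<omega> in M'. L2_inner ?\<mu>' (u' \<omega>) (chi A) = W' (\<lambda>x. inverse \<tau> * a' x) \<omega>"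
      using whittle_matern_solutionD(3)[OF sol' chi[OF A]] by blast
    obtain b' where b': "fractional_power \<kappa> G' len' (- \<alpha> / 2) (chi B) b'"
        "AE \<omega> in M'. L2_inner ?\<mu>' (u' \<omega>) (chi B) = W' (\<lambda>x. inverse \<tau> * b' x) \<omega>"
      using whittle_matern_solutionD(3)[OF sol' chi[OF B]] by blast
    have L2: "a \<in> L2 ?\<mu>" "b \<in> L2 ?\<mu>" "a' \<in> L2 ?\<mu>'" "b' \<in> L2 ?\<mu>'"
      using a(1) b(1) a'(1) b'(1) by (simp_all add: fractional_power_def)
    have aa': "AE x in ?\<mu>. a x = a' (\<iota> x)"
      by (rule fractional_powers_correspond[OF a(1) a'(1) chi_AE])
    have bb': "AE x in ?\<mu>. b x = b' (\<iota> x)"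
      by (rule fractional_powers_correspond[OF b(1) b'(1) chi_AE])
    have "L2_inner ?\<mu> a b = (\<integral>x. a' (\<iota> x) * b' (\<iota> x) \<partial>?\<mu>)"
      unfolding L2_inner_def
    proof (rule integral_cong_AE)
      show "AE x in ?\<mu>. a x * b x = a' (\<iota> x) * b' (\<iota> x)"
        using aa' bb' by eventually_elim simp
    qed (use L2(1,2) L2(3,4)[THEN L2_pullback[OF \<iota> distr]] in \<open>auto dest!: L2_measurable\<close>)
    also have "\<dots> = L2_inner ?\<mu>' a' b'"
      using L2_inner_pullback[OF \<iota> distr L2(3,4)] by (simp add: L2_inner_def)
    finally have inner: "L2_inner ?\<mu> a b = L2_inner ?\<mu>' a' b'" .
    have "(\<integral>\<omega>. L2_inner ?\<mu> (u \<omega>) (indicator A) * L2_inner ?\<mu> (u \<omega>) (indicator B) \<partial>M)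
        = inverse \<tau> * inverse \<tau> * L2_inner ?\<mu> a b"
      by (rule white_noise_image_covariance[OF noise L2(1,2) whittle_matern_solutionD(2)[OF sol ind[OF A]] a(2)
            whittle_matern_solutionD(2)[OF sol ind[OF B]] b(2)])
    moreover have "(\<integral>\<omega>. L2_inner ?\<mu>' (u' \<omega>) (chi A) * L2_inner ?\<mu>' (u' \<omega>) (chi B) \<partial>M')
        = inverse \<tau> * inverse \<tau> * L2_inner ?\<mu>' a' b'"
      by (rule white_noise_image_covariance[OF noise' L2(3,4) whittle_matern_solutionD(2)[OF sol' chi[OF A]] a'(2)
            whittle_matern_solutionD(2)[OF sol' chi[OF B]] b'(2)])
    moreover have "(\<integral>\<omega>. L2_inner ?\<mu> (v' \<omega>) (indicator A) * L2_inner ?\<mu> (v' \<omega>) (indicator B) \<partial>M')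
        = (\<integral>\<omega>. L2_inner ?\<mu>' (u' \<omega>) (chi A) * L2_inner ?\<mu>' (u' \<omega>) (chi B) \<partial>M')"
      by (rule Bochner_Integration.integral_cong) (simp_all add: inner_chi A B)
    ultimately show ?thesis using inner by simp
  qed
  have "AE p in ?\<mu> \<Otimes>\<^sub>M ?\<mu>. covariance_fun M u (fst p) (snd p) = covariance_fun M' v' (fst p) (snd p)"
    by (rule AE_eq_if_rectangle_integrals_eq[OF K(2) K'(2)]) (simp only: K(3) K'(3) moments)
  with K(1) K'(1) show ?thesis
    by eventually_elim (simp add: case_prod_beta' v'_def covariance_fun_def)
qed

theorem proposition2:
  fixes G :: "('v, 'e) pre_digraph" and len :: "'e \<Rightarrow> real" and v :: 'v and k l :: 'e
    and \<kappa> \<tau> \<alpha> :: real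
    and M :: "'w measure" and W :: "('e point \<Rightarrow> real) \<Rightarrow> 'w \<Rightarrow> real" and u :: "'w \<Rightarrow> 'e point \<Rightarrow> real"
    and M' :: "'w2 measure" and W' :: "('e point \<Rightarrow> real) \<Rightarrow> 'w2 \<Rightarrow> real" and u' :: "'w2 \<Rightarrow> 'e point \<Rightarrow> real"
  defines "G' \<equiv> merge_graph G v k l" and "len' \<equiv> merge_len len k l"
    and "\<iota> \<equiv> merge_point G len v k l"
  assumes "0 < \<kappa>" and "0 < \<tau>" and "1 / 2 < \<alpha>"
    and "compact_metric_graph G len"
    and "v \<in> verts G" and "in_degree G v + out_degree G v = 2"
    and "k \<noteq> l" and "incident G k v" and "incident G l v"
    and "gaussian_white_noise M (graph_measure G len) W"
    and "whittle_matern_solution M W \<kappa> \<tau> \<alpha> G len u"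
    and "gaussian_white_noise M' (graph_measure G' len') W'"
    and "whittle_matern_solution M' W' \<kappa> \<tau> \<alpha> G' len' u'"
  shows "AE (s, s') in graph_measure G len \<Otimes>\<^sub>M graph_measure G len.
           integrable M (\<lambda>\<omega>. u \<omega> s * u \<omega> s') \<and>
           integrable M' (\<lambda>\<omega>. u' \<omega> (\<iota> s) * u' \<omega> (\<iota> s')) \<and>
           covariance_fun M u s s' = covariance_fun M' u' (\<iota> s) (\<iota> s')"
proof -
  interpret degree_two_vertex G len v k l
    using assms(7,9-12) by (intro degree_two_vertex.intro degree_two_vertex_axioms.intro)
  show ?thesis
    unfolding \<iota>_def
    by (rule covariance_invariant[OF assms(13,14) assms(15,16)[unfolded G'_def len'_def]])
qed

end
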